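(* Suppose that for each $l=1,\dots,M+Q$ the induced subgraph $\mathcal{G}^{[l]}$ is undirected and connected, and that for each $i\in\mathcal{V}$: $f_i$ is $\nu$-strongly convex with $\nu>0$ and has $\alpha$-Lipschitz gradient for some $\alpha>0$, and the matrix whose rows are $A_i^{[m]}$, $m\in\mathcal{I}_i$, and $E_i^{[q]}$, $q\in\mathcal{E}_i$, has full row rank. Let $\phi(y)=\sum_{i=1}^N\phi_i(y_i)$, where $\phi_i(y_i)$ is the optimal value of the local problem $(\mathrm{P}_i)$ defined in the context. Then: (i) $\phi$ is convex and differentiable; (ii) the gradients of $\phi$ are given by $$\nabla_{y^{[m]}}\phi(y)=(I-P^{[m]})^T\,\mathrm{col}\big(\{\mu_i^{[m]}(y_i)\}_{i\in\mathcal{V}^{[m]}}\big),\quad m=1,\dots,M,$$ $$\nabla_{y^{[M+q]}}\phi(y)=(I-P^{[M+q]})^T\,\mathrm{col}\big(\{\lambda_i^{[q]}(y_i)\}_{i\in\mathcal{V}^{[M+q]}}\big),\quad q=1,\dots,Q,$$ where $\mu_i^{[m]}(y_i)$ and $\lambda_i^{[q]}(y_i)$ are the KKT multipliers associated with the corresponding inequality and equality constraints of $(\mathrm{P}_i)$; (iii) $\phi$ has $\alpha_\phi$-Lipschitz continuous gradient for some finite $\alpha_\phi$.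
   Context: Agents are indexed by $\mathcal{V}=\{1,\dots,N\}$. For each agent $i$: $x_i\in\mathbb{R}^{d_i}$, $f_i:\mathbb{R}^{d_i}\to\mathbb{R}$, $A_i\in\mathbb{R}^{M\times d_i}$, $b_i\in\mathbb{R}^M$, $E_i\in\mathbb{R}^{Q\times d_i}$, $g_i\in\mathbb{R}^Q$. $A_i^{[m]}$ is the $m$-th row of $A_i$, $b_i^{[m]}$ the $m$-th entry of $b_i$; $E_i^{[q]}$, $g_i^{[q]}$ similarly. $f$ is $\nu$-strongly convex if $f(y)-f(x)\ge\langle\nabla f(x),y-x\rangle+\frac{\nu}{2}\|y-x\|^2$ for all $x,y$. Affected agents: $\mathcal{V}^{[m]}=\{j: A_j^{[m]}\ne 0 \text{ or } b_j^{[m]}\neq 0\}$ for $m=1,\dots,M$, and $\mathcal{V}^{[M+q]}=\{j: E_j^{[q]}\ne0\text{ or }g_j^{[q]}\ne0\}$ for $q=1,\dots,Q$. $\mathcal{I}_i=\{m: i\in\mathcal{V}^{[m]}\}$ and $\mathcal{E}_i=\{q: i\in\mathcal{V}^{[M+q]}\}$ are the sets of inequality and equality constraints affecting agent $i$. Communication: $\mathcal{G}=(\mathcal{V},\mathcal{S})$ is an undirected graph; $\mathcal{G}^{[l]}$ is the subgraph of $\mathcal{G}$ induced by $\mathcal{V}^{[l]}$, $l=1,\dots,M+Q$; $\mathcal{N}_i^{[l]}$ is the set of neighbors of $i$ in $\mathcal{G}^{[l]}$, including $i$ itself. For each $l$, $P^{[l]}=[p_{ij}^{[l]}]$ is a symmetric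 nonnegative matrix with rows and columns indexed by $\mathcal{V}^{[l]}$, with $p_{ij}^{[l]}>0$ if $j\in\mathcal{N}_i^{[l]}$, $p_{ij}^{[l]}=0$ otherwise, and $\sum_j p_{ij}^{[l]}=1$ for all $i$. Auxiliary variables: $y^{[l]}=\mathrm{col}(\{y_i^{[l]}\}_{i\in\mathcal{V}^{[l]}})\in\mathbb{R}^{|\mathcal{V}^{[l]}|}$ ($\mathrm{col}$ denotes stacking), $y=\mathrm{col}(y^{[1]},\dots,y^{[M+Q]})$, and $y_i$ is the collection of those $y_j^{[l]}$ with $j\in\mathcal{N}_i^{[l]}$, $l\in\mathcal{I}_i\cup\{M+q:q\in\mathcal{E}_i\}$. Local problem: for given $y_i$, $$(\mathrm{P}_i)\quad \phi_i(y_i)=\min_{x_i} f_i(x_i)\ \text{ s.t. }\ A_i^{[m]}x_i+y_i^{[m]}-\sum_{j}p_{ij}^{[m]}y_j^{[m]}+b_i^{[m]}\le0,\ m\in\mathcal{I}_i,$$ $$E_i^{[q]}x_i+y_i^{[M+q]}-\sum_j p_{ij}^{[M+q]}y_j^{[M+q]}+g_i^{[q]}=0,\ q\in\mathcal{E}_i.$$ Its KKT multipliers $\mu_i(y_i)=\mathrm{col}(\{\mu_i^{[m]}(y_i)\}_{m\in\mathcal{I}_i})\ge0$ (inequalities) and $\lambda_i(y_i)=\mathrm{col}(\{\lambda_i^{[q]}(y_i)\}_{q\in\mathcal{E}_i})$ (equalities) are those satisfying, at the optimum $x_i(y_i)$, stationarity $\nabla f_i(x_i(y_i))+\sum_{m\in\mathcal{I}_i}\mu_i^{[m]}(A_i^{[m]})^T+\sum_{q\in\mathcal{E}_i}\lambda_i^{[q]}(E_i^{[q]})^T=0$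 and complementary slackness for each inequality constraint. *)

theory Defs
  imports "HOL-Analysis.Analysis" "Graph_Theory.Graph_Theory"
begin

section \<open>Euclidean spaces of varying finite dimension\<close>

text \<open>
  The dimensions \<open>d\<^sub>i\<close> differ from agent to agent and the index set of the auxiliary vector \<open>y\<close>
  depends on the data, so they cannot be types. All vectors live in one inner product space of
  finitely supported real families, and for a finite index set \<open>K\<close> the space \<open>\<real>\<^sup>K\<close> is the subspace
  \<open>coord_space K\<close> of the vectors supported in \<open>K\<close>. On it, \<open>inner\<close> and \<open>norm\<close>
  are the standard Euclidean ones. Functions on \<open>\<real>\<^sup>K\<close> are total functions whose values outside
  the subspace are never used; derivatives are taken within the subspace.
\<close>

typedef 'k fvec = "{v :: 'k \<Rightarrow> real. finite {k. v k \<noteq> 0}}"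
  morphisms coord Abs_fvec
  by (rule exI[of _ "\<lambda>_. 0"]) simp

setup_lifting type_definition_fvec

lemma finite_coord [simp]: "finite {k. coord v k \<noteq> 0}"
  using coord[of v] by simp

lemma fvec_eqI: "(\<And>k. coord u k = coord v k) \<Longrightarrow> u = v"
  by transfer auto

instantiation fvec :: (type) real_vector
begin

lift_definition zero_fvec :: "'a fvec" is "\<lambda>_. 0" by simp

lift_definition plus_fvec :: "'a fvec \<Rightarrow> 'a fvec \<Rightarrow> 'a fvec" is "\<lambda>u v k. u k + v k"
  subgoal for u v by (rule finite_subset[of _ "{k. u k \<noteq> 0} \<union> {k. v k \<noteq> 0}"]) auto
  done

lift_definition uminus_fvec :: "'a fvec \<Rightarrow> 'a fvec" is "\<lambda>u k. - u k" by simp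

lift_definition minus_fvec :: "'a fvec \<Rightarrow> 'a fvec \<Rightarrow> 'a fvec" is "\<lambda>u v k. u k - v k"
  subgoal for u v by (rule finite_subset[of _ "{k. u k \<noteq> 0} \<union> {k. v k \<noteq> 0}"]) auto
  done

lift_definition scaleR_fvec :: "real \<Rightarrow> 'a fvec \<Rightarrow> 'a fvec" is "\<lambda>c u k. c * u k"
  by (rule finite_subset[rotated]) auto

instance
  by standard (transfer; simp add: fun_eq_iff algebra_simps)+

end

lemma coord_zero [simp]: "coord 0 k = 0"
  and coord_add [simp]: "coord (u + v) k = coord u k + coord v k"
  and coord_uminus [simp]: "coord (- u) k = - coord u k"
  and coord_diff [simp]: "coord (u - v) k = coord u k - coord v k"
  and coord_scaleR [simp]: "coord (c *\<^sub>R u) k = c * coord u k"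
  by (transfer; simp)+

instantiation fvec :: (type) real_inner
begin

definition inner_fvec :: "'a fvec \<Rightarrow> 'a fvec \<Rightarrow> real" where
  "inner_fvec u v = (\<Sum>k | coord u k \<noteq> 0. coord u k * coord v k)"

definition norm_fvec :: "'a fvec \<Rightarrow> real" where
  "norm_fvec u = sqrt (inner u u)"

definition dist_fvec :: "'a fvec \<Rightarrow> 'a fvec \<Rightarrow> real" where
  "dist_fvec u v = norm (u - v)"

definition sgn_fvec :: "'a fvec \<Rightarrow> 'a fvec" where
  "sgn_fvec u = inverse (norm u) *\<^sub>R u"

definition uniformity_fvec :: "('a fvec \<times> 'a fvec) filter" where
  "uniformity_fvec = (INF e\<in>{0<..}. principal {(u, v). dist u v < e})"

definition open_fvec :: "'a fvec set \<Rightarrow> bool" where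
  "open_fvec U \<longleftrightarrow> (\<forall>u\<in>U. \<forall>\<^sub>F (u', v) in uniformity. u' = u \<longrightarrow> v \<in> U)"

lemma inner_fvec_superset:
  assumes "finite K" "{k. coord u k \<noteq> 0} \<subseteq> K"
  shows "inner u v = (\<Sum>k\<in>K. coord u k * coord v k)"
  unfolding inner_fvec_def using assms by (intro sum.mono_neutral_left) auto

instance
proof
  fix u v w :: "'a fvec" and c :: real
  let ?K = "{k. coord u k \<noteq> 0} \<union> {k. coord v k \<noteq> 0}"
  have K: "finite ?K" by simp
  show "inner u v = inner v u"
    using inner_fvec_superset[OF K, of u v] inner_fvec_superset[OF K, of v u]
    by (simp add: mult.commute)
  have "{k. coord (u + v) k \<noteq> 0} \<subseteq> ?K" by auto
  then show "inner (u + v) w = inner u w + inner v w"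
    using inner_fvec_superset[OF K, of u w] inner_fvec_superset[OF K, of v w]
      inner_fvec_superset[OF K, of "u + v" w]
    by (simp add: sum.distrib[symmetric] distrib_right)
  show "inner (c *\<^sub>R u) v = c * inner u v"
  proof -
    have "{k. coord (c *\<^sub>R u) k \<noteq> 0} \<subseteq> {k. coord u k \<noteq> 0}" by auto
    then show ?thesis
      using inner_fvec_superset[OF finite_coord, of "c *\<^sub>R u" u v]
      by (simp add: inner_fvec_def[of u v] sum_distrib_left mult.assoc)
  qed
  show "0 \<le> inner u u"
    by (simp add: inner_fvec_def sum_nonneg)
  show "inner u u = 0 \<longleftrightarrow> u = 0"
    by (auto simp: inner_fvec_def sum_nonneg_eq_0_iff intro!: fvec_eqI)
  show "norm u = sqrt (inner u u)" by (rule norm_fvec_def)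
  show "dist u v = norm (u - v)" by (rule dist_fvec_def)
  show "sgn u = inverse (norm u) *\<^sub>R u" by (rule sgn_fvec_def)
  show "uniformity = (INF e\<in>{0<..}. principal {(u::'a fvec, v). dist u v < e})"
    by (rule uniformity_fvec_def)
  show "open U = (\<forall>u\<in>U. \<forall>\<^sub>F (u', v) in uniformity. u' = u \<longrightarrow> v \<in> U)" for U :: "'a fvec set"
    by (rule open_fvec_def)
qed

end

definition coord_space :: "'k set \<Rightarrow> 'k fvec set" where
  "coord_space K = {v. \<forall>k. k \<notin> K \<longrightarrow> coord v k = 0}"

lift_definition restrict_coords :: "'k set \<Rightarrow> 'k fvec \<Rightarrow> 'k fvec"
  is "\<lambda>K v k. if k \<in> K then v k else 0"
  by (rule finite_subset[rotated]) auto

lemma coord_restrict_coords [simp]: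
  "coord (restrict_coords K v) k = (if k \<in> K then coord v k else 0)"
  by transfer simp


section \<open>Gradients and strong convexity\<close>

text \<open>
  The gradient at \<open>x\<close> of a function on the linear subspace \<open>U\<close>; meaningful where the function is
  differentiable within \<open>U\<close>. Requiring \<open>g \<in> U\<close> makes it unique.
\<close>

definition gradient :: "'a::real_inner set \<Rightarrow> ('a \<Rightarrow> real) \<Rightarrow> 'a \<Rightarrow> 'a" where
  "gradient U f x = (THE g. g \<in> U \<and> (f has_derivative (\<lambda>h. inner g h)) (at x within U))"

definition strongly_convex_on :: "real \<Rightarrow> 'a::real_inner set \<Rightarrow> ('a \<Rightarrow> real) \<Rightarrow> bool" where
  "strongly_convex_on \<nu> U f \<longleftrightarrow>
    (\<forall>x\<in>U. \<forall>y\<in>U. f y - f x \<ge> inner (gradient U f x) (y - x) + \<nu> / 2 * (norm (y - x))\<^sup>2)"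


section \<open>Problem data\<close>

text \<open>
  The matrices \<open>A\<^sub>i\<close> and \<open>E\<^sub>i\<close> are given by their rows: \<open>ineq_row p i m\<close> is the \<open>m\<close>-th row of \<open>A\<^sub>i\<close>
  and \<open>ineq_off p i m\<close> the \<open>m\<close>-th entry of \<open>b\<^sub>i\<close>; likewise \<open>eq_row\<close>, \<open>eq_off\<close> for \<open>E\<^sub>i\<close>, \<open>g\<^sub>i\<close>.
  The entry \<open>p\<^sub>i\<^sub>j\<close> of \<open>P\<close> for the constraint \<open>l\<close> is \<open>weight p l i j\<close>.
\<close>

record problem =
  n_agents :: nat
  n_ineq :: nat
  n_eq :: nat
  dim_of :: "nat \<Rightarrow> nat"
  cost :: "nat \<Rightarrow> nat fvec \<Rightarrow> real"
  ineq_row :: "nat \<Rightarrow> nat \<Rightarrow> nat fvec"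
  ineq_off :: "nat \<Rightarrow> nat \<Rightarrow> real"
  eq_row :: "nat \<Rightarrow> nat \<Rightarrow> nat fvec"
  eq_off :: "nat \<Rightarrow> nat \<Rightarrow> real"
  network :: "nat pair_pre_digraph"
  weight :: "nat \<Rightarrow> nat \<Rightarrow> nat \<Rightarrow> real"

definition agents :: "problem \<Rightarrow> nat set" where
  "agents p = {1..n_agents p}"

definition constraints :: "problem \<Rightarrow> nat set" where
  "constraints p = {1..n_ineq p + n_eq p}"

definition local_space :: "problem \<Rightarrow> nat \<Rightarrow> nat fvec set" where
  "local_space p i = coord_space {1..dim_of p i}"

text \<open>Constraint \<open>l\<close> is the inequality \<open>l\<close> if \<open>l \<le> M\<close>, and the equality \<open>l - M\<close> otherwise.\<close>

definition affected :: "problem \<Rightarrow> nat \<Rightarrow> nat set" where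
  "affected p l = {j \<in> agents p.
     if l \<le> n_ineq p then ineq_row p j l \<noteq> 0 \<or> ineq_off p j l \<noteq> 0
     else eq_row p j (l - n_ineq p) \<noteq> 0 \<or> eq_off p j (l - n_ineq p) \<noteq> 0}"

definition ineqs :: "problem \<Rightarrow> nat \<Rightarrow> nat set" where
  "ineqs p i = {m \<in> {1..n_ineq p}. i \<in> affected p m}"

definition eqs :: "problem \<Rightarrow> nat \<Rightarrow> nat set" where
  "eqs p i = {q \<in> {1..n_eq p}. i \<in> affected p (n_ineq p + q)}"

definition subnetwork :: "problem \<Rightarrow> nat \<Rightarrow> (nat, nat \<times> nat) pre_digraph" where
  "subnetwork p l = induce_subgraph (with_proj (network p)) (affected p l)"

definition nbrs :: "problem \<Rightarrow> nat \<Rightarrow> nat \<Rightarrow> nat set" where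
  "nbrs p l i = {j \<in> affected p l. j = i \<or> i \<rightarrow>\<^bsub>subnetwork p l\<^esub> j}"

definition mixing_weights :: "problem \<Rightarrow> nat \<Rightarrow> bool" where
  "mixing_weights p l \<longleftrightarrow>
     (\<forall>i\<in>affected p l.
        (\<forall>j\<in>affected p l. weight p l i j = weight p l j i \<and>
           (if j \<in> nbrs p l i then weight p l i j > 0 else weight p l i j = 0)) \<and>
        (\<Sum>j\<in>affected p l. weight p l i j) = 1)"

text \<open>The rows of the matrix required to have full row rank.\<close>

definition local_rows :: "problem \<Rightarrow> nat \<Rightarrow> nat fvec set" where
  "local_rows p i = ineq_row p i ` ineqs p i \<union> eq_row p i ` eqs p i"


section \<open>The local problems and their value functions\<close>

text \<open>
  The auxiliary vector \<open>y\<close> has the coordinates \<open>(l, j)\<close> with \<open>j\<close> affected by \<open>l\<close>; the part \<open>y\<^sub>i\<close>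
  known to agent \<open>i\<close> has those in \<open>local_index p i\<close>.
\<close>

definition aux_index :: "problem \<Rightarrow> (nat \<times> nat) set" where
  "aux_index p = Sigma (constraints p) (affected p)"

definition local_index :: "problem \<Rightarrow> nat \<Rightarrow> (nat \<times> nat) set" where
  "local_index p i =
     (SIGMA l : ineqs p i \<union> (\<lambda>q. n_ineq p + q) ` eqs p i. nbrs p l i)"

definition aux_space :: "problem \<Rightarrow> (nat \<times> nat) fvec set" where
  "aux_space p = coord_space (aux_index p)"

abbreviation local_aux :: "problem \<Rightarrow> nat \<Rightarrow> (nat \<times> nat) fvec \<Rightarrow> (nat \<times> nat) fvec" where
  "local_aux p i y \<equiv> restrict_coords (local_index p i) y"

definition ineq_fun :: "problem \<Rightarrow> nat \<Rightarrow> (nat \<times> nat) fvec \<Rightarrow> nat \<Rightarrow> nat fvec \<Rightarrow> real" where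
  "ineq_fun p i yi m x =
     inner (ineq_row p i m) x + coord yi (m, i)
       - (\<Sum>j\<in>nbrs p m i. weight p m i j * coord yi (m, j)) + ineq_off p i m"

definition eq_fun :: "problem \<Rightarrow> nat \<Rightarrow> (nat \<times> nat) fvec \<Rightarrow> nat \<Rightarrow> nat fvec \<Rightarrow> real" where
  "eq_fun p i yi q x = (let l = n_ineq p + q in
     inner (eq_row p i q) x + coord yi (l, i)
       - (\<Sum>j\<in>nbrs p l i. weight p l i j * coord yi (l, j)) + eq_off p i q)"

definition feasible :: "problem \<Rightarrow> nat \<Rightarrow> (nat \<times> nat) fvec \<Rightarrow> nat fvec set" where
  "feasible p i yi = {x \<in> local_space p i.
     (\<forall>m\<in>ineqs p i. ineq_fun p i yi m x \<le> 0) \<and> (\<forall>q\<in>eqs p i. eq_fun p i yi q x = 0)}"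

definition local_value :: "problem \<Rightarrow> nat \<Rightarrow> (nat \<times> nat) fvec \<Rightarrow> real" where
  "local_value p i yi = (INF x\<in>feasible p i yi. cost p i x)"

definition local_minimizer :: "problem \<Rightarrow> nat \<Rightarrow> (nat \<times> nat) fvec \<Rightarrow> nat fvec \<Rightarrow> bool" where
  "local_minimizer p i yi x \<longleftrightarrow>
     x \<in> feasible p i yi \<and> (\<forall>z\<in>feasible p i yi. cost p i x \<le> cost p i z)"

definition KKT_multipliers ::
  "problem \<Rightarrow> nat \<Rightarrow> (nat \<times> nat) fvec \<Rightarrow> nat fvec \<Rightarrow> nat fvec \<Rightarrow> bool" where
  "KKT_multipliers p i yi mu lam \<longleftrightarrow>
     mu \<in> coord_space (ineqs p i) \<and> lam \<in> coord_space (eqs p i) \<and>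
     (\<forall>m\<in>ineqs p i. coord mu m \<ge> 0) \<and>
     (\<exists>x. local_minimizer p i yi x \<and>
        gradient (local_space p i) (cost p i) x
          + (\<Sum>m\<in>ineqs p i. coord mu m *\<^sub>R ineq_row p i m)
          + (\<Sum>q\<in>eqs p i. coord lam q *\<^sub>R eq_row p i q) = 0 \<and>
        (\<forall>m\<in>ineqs p i. coord mu m * ineq_fun p i yi m x = 0))"

definition total_value :: "problem \<Rightarrow> (nat \<times> nat) fvec \<Rightarrow> real" where
  "total_value p y = (\<Sum>i\<in>agents p. local_value p i (local_aux p i y))"

text \<open>The \<open>i\<close>-th entry of \<open>(I - P)\<^sup>T v\<close> for the matrix \<open>P\<close> of the constraint \<open>l\<close>.\<close>

definition I_minus_P_transpose :: "problem \<Rightarrow> nat \<Rightarrow> (nat \<Rightarrow> real) \<Rightarrow> nat \<Rightarrow> real" where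
  "I_minus_P_transpose p l v i =
     (\<Sum>j\<in>affected p l. ((if j = i then 1 else 0) - weight p l j i) * v j)"

end

theory Submission
  imports Defs
begin

text \<open>
  The linearly independent rows of a local problem have a dual family \<open>d\<close>, so the multipliers at an
  optimum \<open>x\<close> are \<open>w\<^sub>k = - \<langle>\<nabla>f(x), d\<^sub>k\<rangle>\<close>, and moving along \<open>d\<^sub>k\<close> shows that they satisfy the KKT
  conditions. For a KKT point \<open>(x, w)\<close> at constraint offsets \<open>c\<close> and a feasible point \<open>z\<close> at offsets
  \<open>c'\<close>, strong convexity gives \<open>f(z) \<ge> f(x) + \<langle>w, c' - c\<rangle> + \<nu>/2 \<parallel>z - x\<parallel>\<^sup>2\<close>. Hence \<open>w\<close> is a subgradient of
  the optimal value as a function of \<open>c\<close>; adding the inequality with the roles exchanged bounds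
  \<open>\<parallel>x' - x\<parallel>\<close>, and with it \<open>\<parallel>w' - w\<parallel>\<close>, by a multiple of \<open>\<parallel>c' - c\<parallel>\<close>. A function with a Lipschitz field of
  subgradients is convex and differentiable, and the field is its gradient.
\<close>

section \<open>Coordinate spaces\<close>

lift_definition unit_fvec :: "'k \<Rightarrow> 'k fvec" is "\<lambda>k j. if j = k then 1 else 0"
  by simp

lemma coord_unit_fvec [simp]: "coord (unit_fvec k) j = (if j = k then 1 else 0)"
  by transfer simp

lemma coord_sum [simp]: "coord (\<Sum>a\<in>A. g a) k = (\<Sum>a\<in>A. coord (g a) k)"
  by (induction A rule: infinite_finite_induct) auto

lemma inner_unit_fvec [simp]: "inner (unit_fvec k) v = coord v k"
  using inner_fvec_superset[of "{k}" "unit_fvec k" v] by auto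

lemma subspace_coord_space: "subspace (coord_space K)"
  by (auto simp: subspace_def coord_space_def)

lemma unit_fvec_in_coord_space [simp]: "unit_fvec k \<in> coord_space K \<longleftrightarrow> k \<in> K"
  by (auto simp: coord_space_def)

lemma coord_space_expansion:
  assumes "finite K" "v \<in> coord_space K"
  shows "v = (\<Sum>k\<in>K. coord v k *\<^sub>R unit_fvec k)"
proof (rule fvec_eqI)
  fix j
  have "(\<Sum>k\<in>K. coord v k * (if j = k then 1 else 0)) = (if j \<in> K then coord v j else 0)"
    using assms(1) by (simp add: sum.delta if_distrib cong: if_cong)
  then show "coord v j = coord (\<Sum>k\<in>K. coord v k *\<^sub>R unit_fvec k) j"
    using assms(2) by (auto simp: coord_space_def)
qed

lemma abs_coord_le_norm: "\<bar>coord v k\<bar> \<le> norm (v :: 'k fvec)"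
proof -
  have "norm (unit_fvec k :: 'k fvec) = 1"
    by (simp add: norm_eq_sqrt_inner)
  then show ?thesis
    using Cauchy_Schwarz_ineq2[of "unit_fvec k" v] by simp
qed

text \<open>The ambient space need not be finite dimensional, so compactness is built one coordinate
  at a time: the cube over \<open>insert k K\<close> is the continuous image of an interval times
  the cube over \<open>K\<close>, under \<open>(t, v)\<close> to \<open>t e_k + v\<close>.\<close>

lemma compact_coord_cube:
  assumes "finite K"
  shows "compact {v \<in> coord_space K. \<forall>k\<in>K. \<bar>coord v k\<bar> \<le> R}"
  using assms
proof (induction K)
  case empty
  have "{v :: 'a fvec. v \<in> coord_space {}} = {0}"
    by (auto simp: coord_space_def intro!: fvec_eqI)
  then show ?case by simp
next
  case (insert k K)
  let ?C = "\<lambda>K. {v \<in> coord_space K. \<forall>k\<in>K. \<bar>coord v k\<bar> \<le> R}"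
  let ?h = "\<lambda>(t, v). t *\<^sub>R unit_fvec k + v"
  have "?C (insert k K) = ?h ` ({-R..R} \<times> ?C K)"
  proof (intro equalityI subsetI)
    fix v assume v: "v \<in> ?C (insert k K)"
    let ?w = "v - coord v k *\<^sub>R unit_fvec k"
    have "?w \<in> ?C K" "coord v k \<in> {-R..R}"
      using v insert.hyps by (auto simp: coord_space_def)
    moreover have "v = ?h (coord v k, ?w)" by simp
    ultimately show "v \<in> ?h ` ({-R..R} \<times> ?C K)" by blast
  next
    fix v assume "v \<in> ?h ` ({-R..R} \<times> ?C K)"
    then show "v \<in> ?C (insert k K)"
      using insert.hyps by (auto simp: coord_space_def)
  qed
  moreover have "compact ({-R..R} \<times> ?C K)"
    using insert.IH by (intro compact_Times) auto
  moreover have "continuous_on ({-R..R} \<times> ?C K) ?h"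
    unfolding case_prod_unfold by (intro continuous_intros)
  ultimately show ?case
    by (simp only: compact_continuous_image)
qed

text \<open>Coordinates are bounded by the norm, so the ball lies in a coordinate cube and is a
  closed part of a compact set.\<close>

lemma compact_coord_space_cball:
  assumes "finite K"
  shows "compact (coord_space K \<inter> cball a \<rho>)"
proof -
  let ?C = "{v \<in> coord_space K. \<forall>k\<in>K. \<bar>coord v k\<bar> \<le> norm a + \<rho>}"
  have "\<bar>coord v k\<bar> \<le> norm a + \<rho>" if "v \<in> cball a \<rho>" for v k
  proof -
    have "norm v \<le> norm a + norm (v - a)"
      using norm_triangle_ineq[of a "v - a"] by simp
    then show ?thesis
      using abs_coord_le_norm[of v k] that by (simp add: dist_norm norm_minus_commute)
  qed
  then have "coord_space K \<inter> cball a \<rho> = ?C \<inter> cball a \<rho>" by auto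
  then show ?thesis
    using compact_coord_cube[OF assms] by (simp add: compact_Int_closed)
qed


section \<open>Gradients within a subspace\<close>

text \<open>Two candidates \<open>g\<close> and \<open>g'\<close> make the zero function have
  derivative \<open>inner (g' - g)\<close> within \<open>U\<close>. Restricting to the line through
  \<open>x\<close> in direction \<open>g' - g\<close>, which stays in \<open>U\<close>, forces
  \<open>g' - g\<close> to have norm zero.\<close>

lemma gradient_eqI:
  assumes U: "subspace U" and x: "x \<in> U" and g: "g \<in> U"
    and D: "(f has_derivative (\<lambda>h. inner g h)) (at x within U)"
  shows "gradient U f x = g"
  unfolding gradient_def
proof (rule the_equality)
  show "g \<in> U \<and> (f has_derivative (\<lambda>h. inner g h)) (at x within U)"
    using g D by blast
next
  fix g' assume g': "g' \<in> U \<and> (f has_derivative (\<lambda>h. inner g' h)) (at x within U)"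
  let ?v = "g' - g"
  have v: "?v \<in> U" using U g g' by (simp add: subspace_diff)
  have D0: "((\<lambda>x. f x - f x) has_derivative (\<lambda>h. inner g' h - inner g h)) (at x within U)"
    using g' D by (blast intro: has_derivative_diff)
  have line: "((\<lambda>t. x + t *\<^sub>R ?v) has_derivative (\<lambda>t. t *\<^sub>R ?v)) (at 0 within UNIV)"
    by (auto intro!: derivative_eq_intros)
  have "(\<lambda>t. x + t *\<^sub>R ?v) ` UNIV \<subseteq> U"
    using U x v by (auto intro: subspace_add subspace_scale)
  then have "((\<lambda>x. f x - f x) has_derivative (\<lambda>h. inner g' h - inner g h))
      (at (x + 0 *\<^sub>R ?v) within (\<lambda>t. x + t *\<^sub>R ?v) ` UNIV)"
    using has_derivative_subset[OF D0] by simp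
  from has_derivative_in_compose[OF line this]
  have "((\<lambda>t. 0) has_derivative (\<lambda>t. inner g' (t *\<^sub>R ?v) - inner g (t *\<^sub>R ?v))) (at (0::real))"
    by simp
  moreover have "((\<lambda>t. 0) has_derivative (\<lambda>t. 0 :: real)) (at (0::real))"
    by (rule has_derivative_const)
  ultimately have "(\<lambda>t. inner g' (t *\<^sub>R ?v) - inner g (t *\<^sub>R ?v)) = (\<lambda>t. 0)"
    by (rule has_derivative_unique)
  from fun_cong[OF this, of 1] have "inner ?v ?v = 0"
    by (simp add: inner_diff_left)
  then show "g' = g" by simp
qed

text \<open>Membership in the subspace needs existence of a gradient, since \<open>gradient\<close>
  is a definite description. This is Riesz representation: the coordinates of the gradient are the
  values of the derivative at the unit vectors.\<close>

lemma gradient_in_coord_space: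
  assumes K: "finite K" and x: "x \<in> coord_space K"
    and diff: "f differentiable (at x within coord_space K)"
  shows "gradient (coord_space K) f x \<in> coord_space K"
proof -
  let ?U = "coord_space K"
  obtain D where D: "(f has_derivative D) (at x within ?U)"
    using diff by (auto simp: differentiable_def)
  have lin: "linear D" using D by (rule has_derivative_linear)
  define g where "g = (\<Sum>k\<in>K. D (unit_fvec k) *\<^sub>R unit_fvec k)"
  have gU: "g \<in> ?U" unfolding g_def
    by (intro subspace_sum subspace_scale subspace_coord_space) simp
  have gD: "inner g h = D h" if "h \<in> ?U" for h
  proof -
    have "D h = D (\<Sum>k\<in>K. coord h k *\<^sub>R unit_fvec k)"
      using coord_space_expansion[OF K that] by simp
    also have "\<dots> = (\<Sum>k\<in>K. coord h k * D (unit_fvec k))"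
      by (simp add: linear_sum[OF lin] linear_scale[OF lin])
    finally show ?thesis
      by (simp add: g_def inner_sum_left mult.commute)
  qed
  \<comment> \<open>\<open>D\<close> and \<open>inner g\<close> are known to agree on the subspace
    only; this suffices because the limit within it only sees increments \<open>y - x\<close> from
    the subspace.\<close>
  have "((\<lambda>y. (1 / norm (y - x)) *\<^sub>R (f y - (f x + D (y - x)))) \<longlongrightarrow> 0) (at x within ?U)"
    using D by (simp add: has_derivative_within)
  moreover have "\<forall>\<^sub>F y in at x within ?U. y \<in> ?U"
    by (simp add: eventually_at_filter)
  then have "\<forall>\<^sub>F y in at x within ?U. (1 / norm (y - x)) *\<^sub>R (f y - (f x + D (y - x)))
      = (1 / norm (y - x)) *\<^sub>R (f y - (f x + inner g (y - x)))"
    by eventually_elim (simp add: gD subspace_diff[OF subspace_coord_space] x)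
  ultimately have "((\<lambda>y. (1 / norm (y - x)) *\<^sub>R (f y - (f x + inner g (y - x)))) \<longlongrightarrow> 0)
      (at x within ?U)"
    by (rule Lim_transform_eventually)
  then have "(f has_derivative (\<lambda>h. inner g h)) (at x within ?U)"
    by (simp add: has_derivative_within bounded_linear_inner_right)
  with gU show ?thesis
    using gradient_eqI[OF subspace_coord_space x] by simp
qed

text \<open>The linearization error at \<open>x\<close> is nonnegative by the subgradient inequality
  at \<open>x\<close>. The inequality at \<open>y\<close> bounds it above by
  \<open>inner (G y - G x) (y - x)\<close>, hence by \<open>L\<close> times the squared
  distance.\<close>

lemma subgradient_has_derivative:
  fixes f :: "'a::real_inner \<Rightarrow> real"
  assumes sub: "\<And>x y. x \<in> U \<Longrightarrow> y \<in> U \<Longrightarrow> f y - f x \<ge> inner (G x) (y - x)"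
    and lip: "L-lipschitz_on U G" and x: "x \<in> U"
  shows "(f has_derivative (\<lambda>h. inner (G x) h)) (at x within U)"
  unfolding has_derivative_iff_norm
proof
  show "bounded_linear (\<lambda>h. inner (G x) h)" by (rule bounded_linear_inner_right)
  have "\<bar>f y - f x - inner (G x) (y - x)\<bar> \<le> L * norm (y - x) * norm (y - x)" if y: "y \<in> U" for y
  proof -
    have "f y - f x - inner (G x) (y - x) \<le> inner (G y - G x) (y - x)"
      using sub[OF y x] by (simp add: inner_diff_left inner_diff_right)
    also have "\<dots> \<le> norm (G y - G x) * norm (y - x)" by (rule norm_cauchy_schwarz)
    also have "\<dots> \<le> L * norm (y - x) * norm (y - x)"
      using lipschitz_onD[OF lip y x] by (simp add: dist_norm mult_right_mono)
    finally show ?thesis using sub[OF x y] by linarith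
  qed
  then have *: "norm (f y - f x - inner (G x) (y - x)) / norm (y - x) \<le> L * norm (y - x)"
    if "y \<in> U" for y
    using that by (cases "y = x") (simp_all add: divide_le_eq)
  have "\<forall>\<^sub>F y in at x within U. y \<in> U"
    by (simp add: eventually_at_filter)
  then have ev: "\<forall>\<^sub>F y in at x within U.
      norm (f y - f x - inner (G x) (y - x)) / norm (y - x) \<le> L * norm (y - x)"
    by eventually_elim (rule *)
  have lim: "((\<lambda>y. L * norm (y - x)) \<longlongrightarrow> 0) (at x within U)"
    by (auto intro!: tendsto_eq_intros)
  show "((\<lambda>y. norm (f y - f x - inner (G x) (y - x)) / norm (y - x)) \<longlongrightarrow> 0) (at x within U)"
    by (rule tendsto_sandwich[OF _ ev tendsto_const lim]) simp
qed

lemma subgradient_convex_on: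
  fixes f :: "'a::real_inner \<Rightarrow> real"
  assumes U: "convex U"
    and sub: "\<And>x y. x \<in> U \<Longrightarrow> y \<in> U \<Longrightarrow> f y - f x \<ge> inner (G x) (y - x)"
  shows "convex_on U f"
proof (rule convex_onI[OF _ U])
  fix t :: real and x y :: 'a
  assume t: "0 < t" "t < 1" and xy: "x \<in> U" "y \<in> U"
  let ?z = "(1 - t) *\<^sub>R x + t *\<^sub>R y"
  have z: "?z \<in> U" using U xy t by (simp add: convexD)
  \<comment> \<open>The weighted displacements from \<open>?z\<close> to the two endpoints cancel,
    so the subgradient inequalities at \<open>?z\<close> combine to convexity.\<close>
  have "0 = inner (G ?z) ((1 - t) *\<^sub>R (x - ?z) + t *\<^sub>R (y - ?z))"
    by (simp add: algebra_simps)
  also have "\<dots> = (1 - t) * inner (G ?z) (x - ?z) + t * inner (G ?z) (y - ?z)"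
    by (simp only: inner_add_right inner_scaleR_right)
  also have "\<dots> \<le> (1 - t) * (f x - f ?z) + t * (f y - f ?z)"
    using t by (intro add_mono mult_left_mono sub z xy) auto
  finally show "f ?z \<le> (1 - t) * f x + t * f y" by (simp add: algebra_simps)
qed


section \<open>Dual families\<close>

text \<open>Full row rank concerns the indexed family: a basis chosen among the rows has
  \<open>card K\<close> elements, so no row is repeated and the basis is the whole set of
  rows.\<close>

lemma dim_eq_card_imp_independent:
  assumes K: "finite K" and dim: "dim (r ` K) = card K"
  shows "inj_on r K" "independent (r ` K)"
proof -
  obtain B where B: "B \<subseteq> r ` K" "independent B" "r ` K \<subseteq> span B" "card B = dim (r ` K)"
    by (rule basis_exists)
  have "card B \<le> card (r ` K)" using B(1) K by (intro card_mono) auto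
  then have "card (r ` K) = card K"
    using B(4) dim card_image_le[OF K, of r] by linarith
  then show "inj_on r K" using K by (simp add: eq_card_imp_inj_on)
  have "B = r ` K"
    using B(1,4) dim K \<open>card (r ` K) = card K\<close> by (intro card_subset_eq) auto
  then show "independent (r ` K)" using B(2) by simp
qed

text \<open>The vector dual to \<open>r k\<close> is the component of \<open>r k\<close> orthogonal
  to the span of the other rows, divided by its squared norm; independence makes this component
  nonzero.\<close>

lemma dual_family_exists:
  fixes r :: "'k \<Rightarrow> 'a::real_inner"
  assumes K: "finite K" and inj: "inj_on r K" and ind: "independent (r ` K)"
  obtains d where "\<And>k. k \<in> K \<Longrightarrow> d k \<in> span (r ` K)"
    and "\<And>j k. j \<in> K \<Longrightarrow> k \<in> K \<Longrightarrow> inner (r j) (d k) = (if j = k then 1 else 0)"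
proof -
  have "\<exists>d. d \<in> span (r ` K) \<and> (\<forall>j\<in>K. inner (r j) d = (if j = k then 1 else 0))" if k: "k \<in> K" for k
  proof -
    let ?R = "r ` (K - {k})"
    have "finite ?R" using K by simp
    from basis_orthogonal[OF this]
    obtain C where C: "span C = span ?R" "pairwise orthogonal C" "finite C" by blast
    \<comment> \<open>Projection along an orthogonal generating set. A zero vector in
      \<open>C\<close> does no harm: its summand vanishes.\<close>
    define z where "z = r k - (\<Sum>b\<in>C. (inner b (r k) / inner b b) *\<^sub>R b)"
    have proj: "(\<Sum>b\<in>C. (inner b (r k) / inner b b) *\<^sub>R b) \<in> span ?R"
      unfolding C(1)[symmetric] by (intro span_sum span_scale span_base)
    have "inner b z = 0" if b: "b \<in> C" for b
    proof -
      have "inner b (\<Sum>b'\<in>C. (inner b' (r k) / inner b' b') *\<^sub>R b')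
          = (\<Sum>b'\<in>C. if b' = b then inner b (r k) / inner b b * inner b b else 0)"
        unfolding inner_sum_right using C(2) b
        by (intro sum.cong) (auto simp: pairwise_def orthogonal_def)
      also have "\<dots> = inner b (r k)"
        using C(3) b by simp
      finally show ?thesis by (simp add: z_def inner_diff_right)
    qed
    then have "span C \<subseteq> {v. inner v z = 0}"
      by (intro span_minimal) (auto simp: subspace_def inner_add_left)
    then have orth: "inner v z = 0" if "v \<in> span ?R" for v
      using that C(1) by auto
    have R: "?R = r ` K - {r k}"
      using inj k by (auto simp: inj_on_def)
    have "r k \<notin> span ?R"
      unfolding R using ind k by (auto simp: dependent_def)
    then have "z \<noteq> 0" using proj by (auto simp: z_def)
    \<comment> \<open>The projected part of \<open>r k\<close> is orthogonal to \<open>z\<close>, so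
      the pairing with \<open>r k\<close> is the squared norm by which \<open>z\<close> is then
      divided.\<close>
    have "inner (r k) z = inner z z + inner (\<Sum>b\<in>C. (inner b (r k) / inner b b) *\<^sub>R b) z"
      by (simp add: z_def inner_diff_left)
    then have rz: "inner (r k) z = inner z z" using orth[OF proj] by simp
    have "?R \<subseteq> r ` K" by auto
    then have "span ?R \<subseteq> span (r ` K)" by (rule span_mono)
    then have "z \<in> span (r ` K)"
      using proj k unfolding z_def by (blast intro: span_diff span_base)
    then have "z /\<^sub>R inner z z \<in> span (r ` K)" by (rule span_scale)
    moreover have "inner (r j) (z /\<^sub>R inner z z) = (if j = k then 1 else 0)" if "j \<in> K" for j
    proof (cases "j = k")
      case True
      then show ?thesis using rz \<open>z \<noteq> 0\<close> by simp
    next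
      case False
      then have "inner (r j) z = 0" using that by (intro orth span_base) auto
      then show ?thesis using False by simp
    qed
    ultimately show ?thesis by blast
  qed
  then obtain d where "\<And>k. k \<in> K \<Longrightarrow> d k \<in> span (r ` K)
      \<and> (\<forall>j\<in>K. inner (r j) (d k) = (if j = k then 1 else 0))"
    by metis
  then show ?thesis by (intro that[of d]) auto
qed


section \<open>Strongly convex programs with perturbed affine constraints\<close>

text \<open>Indices in \<open>I\<close> are inequalities, the others equations. The dual family
  \<open>d\<close> encodes linear independence of the rows, and \<open>compact_U\<close> carries the
  finite dimension of \<open>U\<close>. \<open>G\<close> stands for the gradient of \<open>f\<close>
  through the strong convexity inequality.\<close>

locale affine_program =
  fixes U :: "'a::real_inner set" and f :: "'a \<Rightarrow> real" and G :: "'a \<Rightarrow> 'a"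
    and K I :: "'k set" and r d :: "'k \<Rightarrow> 'a" and \<nu> \<alpha> :: real
  assumes subspace_U: "subspace U"
    and compact_U: "\<And>a \<rho>. compact (U \<inter> cball a \<rho>)"
    and G_in: "\<And>x. x \<in> U \<Longrightarrow> G x \<in> U"
    and nu_pos: "\<nu> > 0"
    and strong: "\<And>x y. x \<in> U \<Longrightarrow> y \<in> U \<Longrightarrow>
      f y - f x \<ge> inner (G x) (y - x) + \<nu> / 2 * (norm (y - x))\<^sup>2"
    and lip: "\<alpha>-lipschitz_on U G"
    and finite_K: "finite K"
    and r_in: "\<And>k. k \<in> K \<Longrightarrow> r k \<in> U"
    and d_in: "\<And>k. k \<in> K \<Longrightarrow> d k \<in> U"
    and dual: "\<And>j k. j \<in> K \<Longrightarrow> k \<in> K \<Longrightarrow> inner (r j) (d k) = (if j = k then 1 else 0)"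
begin

section \<open>Feasible points and KKT conditions\<close>

definition feas :: "('k \<Rightarrow> real) \<Rightarrow> 'a set" where
  "feas c = {x \<in> U. \<forall>k\<in>K. if k \<in> I then inner (r k) x + c k \<le> 0 else inner (r k) x + c k = 0}"

text \<open>The values of \<open>w\<close> outside \<open>K\<close> are unconstrained, so
  multipliers are only ever compared on \<open>K\<close>.\<close>

definition kkt :: "('k \<Rightarrow> real) \<Rightarrow> 'a \<Rightarrow> ('k \<Rightarrow> real) \<Rightarrow> bool" where
  "kkt c x w \<longleftrightarrow> x \<in> feas c \<and> (\<forall>k\<in>K \<inter> I. w k \<ge> 0 \<and> w k * (inner (r k) x + c k) = 0)
     \<and> G x + (\<Sum>k\<in>K. w k *\<^sub>R r k) = 0"

lemma alpha_nonneg: "0 \<le> \<alpha>"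
  using lip by (rule lipschitz_on_nonneg)

lemma convex_bound:
  assumes "x \<in> U" "y \<in> U"
  shows "f y - f x \<ge> inner (G x) (y - x)"
proof -
  have "0 \<le> \<nu> / 2 * (norm (y - x))\<^sup>2" using nu_pos by simp
  then show ?thesis using strong[OF assms] by linarith
qed

lemma continuous_f: "continuous_on U f"
  unfolding continuous_on_eq_continuous_within
  using subgradient_has_derivative[OF convex_bound lip] has_derivative_continuous by blast

lemma kkt_in_U: "kkt c x w \<Longrightarrow> x \<in> U"
  by (simp add: kkt_def feas_def)

lemma sum_delta_dual:
  assumes "j \<in> K"
  shows "(\<Sum>k\<in>K. t k * inner (r k) (d j)) = t j" "(\<Sum>k\<in>K. t k * inner (r j) (d k)) = t j"
proof -
  have "(\<Sum>k\<in>K. t k * inner (r k) (d j)) = (\<Sum>k\<in>K. if k = j then t k else 0)"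
    using assms by (intro sum.cong) (auto simp: dual)
  then show "(\<Sum>k\<in>K. t k * inner (r k) (d j)) = t j"
    using assms finite_K by simp
  have "(\<Sum>k\<in>K. t k * inner (r j) (d k)) = (\<Sum>k\<in>K. if k = j then t k else 0)"
    using assms by (intro sum.cong) (auto simp: dual)
  then show "(\<Sum>k\<in>K. t k * inner (r j) (d k)) = t j"
    using assms finite_K by simp
qed

text \<open>Pairing stationarity with \<open>d j\<close> isolates the multiplier \<open>w j\<close>.
  Multipliers thus inherit the Lipschitz bound of \<open>G\<close>.\<close>

lemma kkt_multiplier_eq:
  assumes "kkt c x w" "j \<in> K"
  shows "w j = - inner (G x) (d j)"
proof -
  have "0 = inner (G x + (\<Sum>k\<in>K. w k *\<^sub>R r k)) (d j)"
    using assms(1) by (simp add: kkt_def)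
  also have "\<dots> = inner (G x) (d j) + w j"
    using sum_delta_dual(1)[OF assms(2)] by (simp add: inner_add_left inner_sum_left)
  finally show ?thesis by simp
qed

lemma kkt_inner_G:
  assumes "kkt c x w"
  shows "inner (G x) h = - (\<Sum>k\<in>K. w k * inner (r k) h)"
proof -
  have "inner (G x + (\<Sum>k\<in>K. w k *\<^sub>R r k)) h = 0"
    using assms by (simp add: kkt_def)
  then show ?thesis by (simp add: inner_add_left inner_sum_left)
qed

text \<open>Stationarity replaces the linear term of strong convexity by the multipliers applied to
  the rows, and the claim is checked constraint by constraint.\<close>

lemma kkt_lower_bound:
  assumes kkt: "kkt c x w" and z: "z \<in> feas c'"
  shows "f z \<ge> f x + (\<Sum>k\<in>K. w k * (c' k - c k)) + \<nu> / 2 * (norm (z - x))\<^sup>2"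
proof -
  have zU: "z \<in> U" using z by (simp add: feas_def)
  have "w k * (c' k - c k) \<le> - (w k * inner (r k) (z - x))" if k: "k \<in> K" for k
  proof -
    \<comment> \<open>The gap splits into the slackness product at \<open>x\<close>, which is zero,
      minus the product at \<open>z\<close>, which is nonpositive for an inequality and zero for an
      equation.\<close>
    have *: "- (w k * inner (r k) (z - x)) - w k * (c' k - c k)
        = w k * (inner (r k) x + c k) - w k * (inner (r k) z + c' k)"
      by (simp add: algebra_simps inner_diff_right)
    show ?thesis
    proof (cases "k \<in> I")
      case True
      then have "w k \<ge> 0" "w k * (inner (r k) x + c k) = 0" "inner (r k) z + c' k \<le> 0"
        using kkt z k by (auto simp: kkt_def feas_def)
      moreover then have "w k * (inner (r k) z + c' k) \<le> 0"
        by (simp add: mult_nonneg_nonpos)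
      ultimately show ?thesis using * by linarith
    next
      case False
      then have "inner (r k) x + c k = 0" "inner (r k) z + c' k = 0"
        using kkt z k by (auto simp: kkt_def feas_def)
      then show ?thesis using * by simp
    qed
  qed
  then have "(\<Sum>k\<in>K. w k * (c' k - c k)) \<le> inner (G x) (z - x)"
    unfolding kkt_inner_G[OF kkt] sum_negf[symmetric] by (rule sum_mono)
  then show ?thesis using strong[OF kkt_in_U[OF kkt] zU] by linarith
qed

lemma kkt_minimizer:
  assumes "kkt c x w" "z \<in> feas c"
  shows "f x \<le> f z" and "f z = f x \<Longrightarrow> z = x"
proof -
  have *: "f z \<ge> f x + \<nu> / 2 * (norm (z - x))\<^sup>2"
    using kkt_lower_bound[OF assms] by simp
  moreover have "\<nu> / 2 * (norm (z - x))\<^sup>2 \<ge> 0" using nu_pos by simp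
  ultimately show "f x \<le> f z" by linarith
  assume "f z = f x"
  with * have "\<nu> / 2 * (norm (z - x))\<^sup>2 \<le> 0" by simp
  then show "z = x" using nu_pos by (simp add: mult_le_0_iff)
qed

section \<open>Existence of a minimizer\<close>

lemma closed_feas: "closed {x. \<forall>k\<in>K. if k \<in> I then inner (r k) x + c k \<le> 0 else inner (r k) x + c k = 0}"
proof -
  have "closed {x. inner (r k) x + c k \<le> 0}" "closed {x. inner (r k) x + c k = 0}" for k
    by (intro closed_Collect_le closed_Collect_eq continuous_intros)+
  then have "closed {x. if k \<in> I then inner (r k) x + c k \<le> 0 else inner (r k) x + c k = 0}" for k
    by (cases "k \<in> I") simp_all
  then have "closed (\<Inter>k\<in>K. {x. if k \<in> I then inner (r k) x + c k \<le> 0 else inner (r k) x + c k = 0})"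
    by (rule closed_INT[OF ballI])
  also have "(\<Inter>k\<in>K. {x. if k \<in> I then inner (r k) x + c k \<le> 0 else inner (r k) x + c k = 0})
      = {x. \<forall>k\<in>K. if k \<in> I then inner (r k) x + c k \<le> 0 else inner (r k) x + c k = 0}"
    by blast
  finally show ?thesis .
qed

text \<open>The dual family allows every constraint value to be prescribed independently; the
  witness makes all constraints hold with equality.\<close>

lemma feas_nonempty: "feas c \<noteq> {}"
proof -
  define x where "x = - (\<Sum>k\<in>K. c k *\<^sub>R d k)"
  have "x \<in> U" unfolding x_def
    by (intro subspace_neg subspace_sum subspace_scale subspace_U d_in)
  moreover have "inner (r j) x + c j = 0" if "j \<in> K" for j
    using sum_delta_dual(2)[OF that] by (simp add: x_def inner_sum_right)
  ultimately have "x \<in> feas c" by (simp add: feas_def)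
  then show ?thesis by blast
qed

lemma minimizer_exists: "\<exists>x\<in>feas c. \<forall>z\<in>feas c. f x \<le> f z"
proof -
  obtain a where a: "a \<in> feas c" using feas_nonempty by blast
  then have aU: "a \<in> U" by (simp add: feas_def)
  \<comment> \<open>Beyond this radius the quadratic term of strong convexity at \<open>a\<close>
    outweighs the linear one, so \<open>f\<close> is at least \<open>f a\<close> there and the
    search reduces to a compact set.\<close>
  define \<rho> where "\<rho> = 2 * norm (G a) / \<nu>"
  let ?S = "feas c \<inter> cball a \<rho>"
  have S: "?S = (U \<inter> cball a \<rho>) \<inter>
      {x. \<forall>k\<in>K. if k \<in> I then inner (r k) x + c k \<le> 0 else inner (r k) x + c k = 0}"
    by (auto simp: feas_def)
  have "compact ?S"
    unfolding S by (intro compact_Int_closed compact_U closed_feas)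
  moreover have "a \<in> ?S" using a nu_pos by (simp add: \<rho>_def)
  moreover have "continuous_on ?S f"
    by (rule continuous_on_subset[OF continuous_f]) (auto simp: feas_def)
  ultimately obtain x where x: "x \<in> ?S" "\<And>z. z \<in> ?S \<Longrightarrow> f x \<le> f z"
    using continuous_attains_inf[of ?S f] by blast
  have "f x \<le> f z" if z: "z \<in> feas c" for z
  proof (cases "z \<in> cball a \<rho>")
    case True
    then show ?thesis using x(2) z by blast
  next
    case False
    let ?n = "norm (z - a)"
    have zU: "z \<in> U" using z by (simp add: feas_def)
    from False have "\<rho> < ?n" by (simp add: dist_norm norm_minus_commute)
    then have n: "2 * norm (G a) < \<nu> * ?n"
      using nu_pos by (simp add: \<rho>_def field_simps)
    have "- inner (G a) (z - a) \<le> norm (G a) * ?n"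
      using norm_cauchy_schwarz[of "- G a" "z - a"] by simp
    also have "\<dots> \<le> (\<nu> * ?n / 2) * ?n" using n by (intro mult_right_mono) auto
    also have "\<dots> = \<nu> / 2 * ?n\<^sup>2" by (simp add: power2_eq_square)
    finally have "f a \<le> f z" using strong[OF aU zU] by linarith
    then show ?thesis using x(2)[OF \<open>a \<in> ?S\<close>] by linarith
  qed
  then show ?thesis using x(1) by blast
qed

section \<open>First-order conditions and existence of multipliers\<close>

text \<open>Convexity at the moved point gives \<open>inner (G (x + t h)) h \<ge> 0\<close>;
  returning to \<open>x\<close> costs a multiple of \<open>t\<close> by the Lipschitz bound, and
  \<open>t\<close> tends to zero.\<close>

lemma first_order_condition:
  assumes x: "x \<in> U" and h: "h \<in> U" and "\<epsilon> > 0"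
    and min: "\<And>t. 0 < t \<Longrightarrow> t < \<epsilon> \<Longrightarrow> f x \<le> f (x + t *\<^sub>R h)"
  shows "inner (G x) h \<ge> 0"
proof -
  have "- inner (G x) h \<le> t * (\<alpha> * (norm h)\<^sup>2)" if t: "0 < t" "t < \<epsilon>" for t
  proof -
    let ?y = "x + t *\<^sub>R h"
    have y: "?y \<in> U" using x h by (intro subspace_add subspace_scale subspace_U)
    have "0 \<le> t * inner (G ?y) h"
      using convex_bound[OF y x] min[OF t] by simp
    then have "0 \<le> inner (G ?y) h" using t by (simp add: zero_le_mult_iff)
    moreover have "inner (G ?y - G x) h \<le> t * (\<alpha> * (norm h)\<^sup>2)"
    proof -
      have "inner (G ?y - G x) h \<le> norm (G ?y - G x) * norm h" by (rule norm_cauchy_schwarz)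
      also have "\<dots> \<le> (\<alpha> * norm (?y - x)) * norm h"
        using lipschitz_onD[OF lip y x] by (intro mult_right_mono) (auto simp: dist_norm)
      finally show ?thesis using t by (simp add: power2_eq_square mult_ac)
    qed
    ultimately show ?thesis by (simp add: inner_diff_left)
  qed
  then have ev: "\<forall>\<^sub>F t in at_right 0. - inner (G x) h \<le> t * (\<alpha> * (norm h)\<^sup>2)"
    using \<open>\<epsilon> > 0\<close> by (auto simp: eventually_at_right_field)
  have lim: "((\<lambda>t. t * (\<alpha> * (norm h)\<^sup>2)) \<longlongrightarrow> 0) (at_right 0)"
    by (auto intro!: tendsto_eq_intros)
  have "- inner (G x) h \<le> 0"
    by (rule tendsto_lowerbound[OF lim ev]) simp
  then show ?thesis by simp
qed

text \<open>The dual family provides enough feasible directions to read off the multipliers.\<close>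

lemma minimizer_kkt:
  assumes x: "x \<in> feas c" and min: "\<And>z. z \<in> feas c \<Longrightarrow> f x \<le> f z"
  shows "kkt c x (\<lambda>k. - inner (G x) (d k))"
proof -
  have xU: "x \<in> U" using x by (simp add: feas_def)
  let ?s = "\<lambda>k. inner (r k) x + c k"
  let ?w = "\<lambda>k. - inner (G x) (d k)"
  \<comment> \<open>A direction is admissible if short steps preserve all equations and do not
    exceed the slack of the inequalities.\<close>
  have direction: "inner (G x) h \<ge> 0" if "h \<in> U" "\<epsilon> > 0"
    and dir: "\<And>t k. 0 < t \<Longrightarrow> t < \<epsilon> \<Longrightarrow> k \<in> K \<Longrightarrow>
      if k \<in> I then ?s k + t * inner (r k) h \<le> 0 else inner (r k) h = 0" for h \<epsilon>
  proof (rule first_order_condition[OF xU that(1,2)])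
    fix t :: real assume t: "0 < t" "t < \<epsilon>"
    have "x + t *\<^sub>R h \<in> U" using xU that(1) by (intro subspace_add subspace_scale subspace_U)
    moreover have "if k \<in> I then inner (r k) (x + t *\<^sub>R h) + c k \<le> 0
        else inner (r k) (x + t *\<^sub>R h) + c k = 0" if "k \<in> K" for k
      using x that dir[OF t that]
      by (auto simp: feas_def inner_add_right algebra_simps split: if_splits)
    ultimately show "f x \<le> f (x + t *\<^sub>R h)" by (intro min) (simp add: feas_def)
  qed
  have s: "k \<in> K \<Longrightarrow> k \<in> I \<Longrightarrow> ?s k \<le> 0" for k using x by (auto simp: feas_def)
  \<comment> \<open>If all rows annihilate \<open>h\<close>, both \<open>h\<close> and
    \<open>- h\<close> are admissible.\<close>
  have orth: "inner (G x) h = 0" if h: "h \<in> U" "\<And>k. k \<in> K \<Longrightarrow> inner (r k) h = 0" for h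
  proof -
    have "inner (G x) h \<ge> 0" by (rule direction[of h 1]) (use h s in auto)
    moreover have "inner (G x) (- h) \<ge> 0"
      by (rule direction[of "- h" 1]) (use h s in \<open>auto intro: subspace_neg[OF subspace_U]\<close>)
    ultimately show ?thesis by simp
  qed
  \<comment> \<open>Moving along \<open>- d k\<close> lowers constraint \<open>k\<close> and leaves
    the others unchanged.\<close>
  have nonneg: "?w k \<ge> 0" if k: "k \<in> K" "k \<in> I" for k
  proof -
    have "inner (G x) (- d k) \<ge> 0"
    proof (rule direction[of _ 1])
      fix t :: real and j assume "0 < t" "j \<in> K"
      then show "if j \<in> I then ?s j + t * inner (r j) (- d k) \<le> 0 else inner (r j) (- d k) = 0"
        using k s[of j] by (auto simp: dual)
    qed (use k in \<open>auto intro: subspace_neg[OF subspace_U] d_in\<close>)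
    then show ?thesis by simp
  qed
  have compl: "?w k = 0" if k: "k \<in> K" "k \<in> I" "?s k \<noteq> 0" for k
  proof -
    have "inner (G x) (d k) \<ge> 0"
    proof (rule direction[of _ "- ?s k"])
      \<comment> \<open>Constraint \<open>k\<close> grows at unit rate along \<open>d k\<close>, so
        an inactive constraint permits steps up to its slack. This yields the sign opposite to
        \<open>nonneg\<close>.\<close>
      show "- ?s k > 0" using s[OF k(1,2)] k(3) by linarith
      fix t :: real and j assume "0 < t" "t < - ?s k" "j \<in> K"
      then show "if j \<in> I then ?s j + t * inner (r j) (d k) \<le> 0 else inner (r j) (d k) = 0"
        using k s[of j] by (auto simp: dual)
    qed (use k in \<open>auto intro: d_in\<close>)
    then show ?thesis using nonneg[OF k(1,2)] by simp
  qed
  \<comment> \<open>\<open>z\<close> is the stationarity residual, orthogonal to every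
    \<open>d j\<close> by the choice of \<open>?w\<close>. Subtracting a combination of the
    \<open>d k\<close> gives \<open>h\<close>, annihilated by all rows; then
    \<open>inner z z = inner z h = inner (G x) h = 0\<close>.\<close>
  define z where "z = G x + (\<Sum>k\<in>K. ?w k *\<^sub>R r k)"
  define h where "h = z - (\<Sum>k\<in>K. inner (r k) z *\<^sub>R d k)"
  have zU: "z \<in> U" unfolding z_def
    by (intro subspace_add subspace_sum subspace_scale subspace_U r_in G_in xU)
  have hU: "h \<in> U" unfolding h_def
    by (intro subspace_diff subspace_sum subspace_scale subspace_U d_in zU)
  have rh: "inner (r j) h = 0" if "j \<in> K" for j
    using sum_delta_dual(2)[OF that, of "\<lambda>k. inner (r k) z"]
    by (simp add: h_def inner_diff_right inner_sum_right)
  have zd: "inner z (d j) = 0" if "j \<in> K" for j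
    using sum_delta_dual(1)[OF that, of ?w] by (simp add: z_def inner_add_left inner_sum_left)
  have "inner z h = 0"
    using orth[OF hU rh] rh by (simp add: z_def inner_add_left inner_sum_left)
  moreover have "inner z z = inner z h + (\<Sum>k\<in>K. inner (r k) z * inner z (d k))"
    by (simp add: h_def inner_diff_right inner_sum_right)
  ultimately have "inner z z = 0" using zd by simp
  then have "G x + (\<Sum>k\<in>K. ?w k *\<^sub>R r k) = 0" by (simp add: z_def)
  then show ?thesis using x nonneg compl by (auto simp: kkt_def)
qed

lemma kkt_unique:
  assumes "kkt c x w" "kkt c x' w'"
  shows "x' = x" "k \<in> K \<Longrightarrow> w' k = w k"
proof -
  have "x \<in> feas c" "x' \<in> feas c" using assms by (auto simp: kkt_def)
  then show "x' = x"
    using kkt_minimizer[OF assms(1), of x'] kkt_minimizer(1)[OF assms(2), of x] by simp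
  then show "k \<in> K \<Longrightarrow> w' k = w k"
    using kkt_multiplier_eq[OF assms(1)] kkt_multiplier_eq[OF assms(2)] by simp
qed

lemma kkt_cong:
  assumes "\<And>k. k \<in> K \<Longrightarrow> w k = w' k" "\<And>k. k \<in> K \<Longrightarrow> c k = c' k"
  shows "kkt c x w \<longleftrightarrow> kkt c' x w'"
proof -
  have "(\<Sum>k\<in>K. w k *\<^sub>R r k) = (\<Sum>k\<in>K. w' k *\<^sub>R r k)"
    using assms(1) by (intro sum.cong) auto
  then show ?thesis using assms by (simp add: kkt_def feas_def)
qed

lemma kkt_exists: "\<exists>x w. kkt c x w"
  using minimizer_exists minimizer_kkt by blast

section \<open>Lipschitz dependence on the constraint offsets\<close>

text \<open>In the sum of the two lower bounds the values of \<open>f\<close> cancel, leaving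
  \<open>\<nu>\<close> times the squared displacement below the pairing of multiplier and offset
  differences. The multiplier differences are linear in the displacement, so one factor
  cancels.\<close>

lemma kkt_displacement:
  assumes kkt: "kkt c x w" and kkt': "kkt c' x' w'"
  shows "norm (x' - x) \<le> \<alpha> / \<nu> * (\<Sum>k\<in>K. norm (d k) * \<bar>c' k - c k\<bar>)"
    and "j \<in> K \<Longrightarrow> \<bar>w' j - w j\<bar> \<le> norm (d j) * \<alpha> * norm (x' - x)"
proof -
  let ?n = "norm (x' - x)"
  have x: "x \<in> U" "x \<in> feas c" and x': "x' \<in> U" "x' \<in> feas c'"
    using kkt kkt' by (auto simp: kkt_def feas_def)
  have w: "\<bar>w' k - w k\<bar> \<le> norm (d k) * \<alpha> * ?n" if "k \<in> K" for k
  proof -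
    have "\<bar>w' k - w k\<bar> = \<bar>inner (G x' - G x) (d k)\<bar>"
      using kkt_multiplier_eq[OF kkt that] kkt_multiplier_eq[OF kkt' that]
      by (simp add: inner_diff_left)
    also have "\<dots> \<le> norm (G x' - G x) * norm (d k)" by (rule Cauchy_Schwarz_ineq2)
    also have "\<dots> \<le> \<alpha> * ?n * norm (d k)"
      using lipschitz_onD[OF lip x'(1) x(1)] by (intro mult_right_mono) (auto simp: dist_norm)
    finally show ?thesis by (simp add: mult_ac)
  qed
  then show "j \<in> K \<Longrightarrow> \<bar>w' j - w j\<bar> \<le> norm (d j) * \<alpha> * norm (x' - x)" .
  let ?S = "\<Sum>k\<in>K. norm (d k) * \<bar>c' k - c k\<bar>"
  have "f x' \<ge> f x + (\<Sum>k\<in>K. w k * (c' k - c k)) + \<nu> / 2 * ?n\<^sup>2"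
    by (rule kkt_lower_bound[OF kkt x'(2)])
  moreover have "f x \<ge> f x' + (\<Sum>k\<in>K. w' k * (c k - c' k)) + \<nu> / 2 * ?n\<^sup>2"
    using kkt_lower_bound[OF kkt' x(2)] by (simp add: norm_minus_commute)
  ultimately have "\<nu> * ?n\<^sup>2 \<le> - (\<Sum>k\<in>K. w k * (c' k - c k)) - (\<Sum>k\<in>K. w' k * (c k - c' k))"
    by (simp add: field_simps)
  also have "\<dots> = (\<Sum>k\<in>K. (w' k - w k) * (c' k - c k))"
    by (simp add: sum_negf[symmetric] sum_subtractf[symmetric] algebra_simps)
  also have "\<dots> \<le> (\<Sum>k\<in>K. (norm (d k) * \<alpha> * ?n) * \<bar>c' k - c k\<bar>)"
  proof (rule sum_mono)
    fix k assume "k \<in> K"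
    have "(w' k - w k) * (c' k - c k) \<le> \<bar>w' k - w k\<bar> * \<bar>c' k - c k\<bar>"
      unfolding abs_mult[symmetric] by (rule abs_ge_self)
    also have "\<dots> \<le> (norm (d k) * \<alpha> * ?n) * \<bar>c' k - c k\<bar>"
      using w[OF \<open>k \<in> K\<close>] by (intro mult_right_mono) auto
    finally show "(w' k - w k) * (c' k - c k) \<le> (norm (d k) * \<alpha> * ?n) * \<bar>c' k - c k\<bar>" .
  qed
  also have "\<dots> = ?n * (\<alpha> * ?S)"
    unfolding sum_distrib_left by (intro sum.cong refl) (simp only: mult_ac)
  finally have *: "?n * (\<nu> * ?n) \<le> ?n * (\<alpha> * ?S)"
    unfolding power2_eq_square by (simp only: mult.left_commute)
  have "0 \<le> ?S" by (intro sum_nonneg) auto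
  have "\<nu> * ?n \<le> \<alpha> * ?S"
  proof (cases "?n = 0")
    case True
    then show ?thesis using \<open>0 \<le> ?S\<close> alpha_nonneg by simp
  next
    case False
    then have "?n > 0" by simp
    with * show ?thesis by (rule mult_left_le_imp_le)
  qed
  then show "?n \<le> \<alpha> / \<nu> * ?S"
    using nu_pos by (simp add: field_simps)
qed

lemma multiplier_lipschitz:
  obtains L where "L \<ge> 0"
    "\<And>c x w c' x' w' \<delta> j. kkt c x w \<Longrightarrow> kkt c' x' w' \<Longrightarrow> (\<And>k. k \<in> K \<Longrightarrow> \<bar>c' k - c k\<bar> \<le> \<delta>) \<Longrightarrow>
      \<delta> \<ge> 0 \<Longrightarrow> j \<in> K \<Longrightarrow> \<bar>w' j - w j\<bar> \<le> L * \<delta>"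
proof -
  let ?D = "\<Sum>k\<in>K. norm (d k)"
  \<comment> \<open>The right-hand factor bounds the displacement per unit of offset change, the
    left-hand one the multiplier change per unit of displacement.\<close>
  let ?L = "?D * \<alpha> * (\<alpha> / \<nu> * ?D)"
  have D: "?D \<ge> 0" by (intro sum_nonneg) auto
  have L: "?L \<ge> 0" using D alpha_nonneg nu_pos by simp
  have "\<bar>w' j - w j\<bar> \<le> ?L * \<delta>" if h: "kkt c x w" "kkt c' x' w'"
    "\<And>k. k \<in> K \<Longrightarrow> \<bar>c' k - c k\<bar> \<le> \<delta>" "\<delta> \<ge> 0" "j \<in> K" for c x w c' x' w' \<delta> j
  proof -
    have "(\<Sum>k\<in>K. norm (d k) * \<bar>c' k - c k\<bar>) \<le> (\<Sum>k\<in>K. norm (d k) * \<delta>)"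
      using h(3) by (intro sum_mono mult_left_mono) auto
    also have "\<dots> = ?D * \<delta>" by (rule sum_distrib_right[symmetric])
    finally have "\<alpha> / \<nu> * (\<Sum>k\<in>K. norm (d k) * \<bar>c' k - c k\<bar>) \<le> \<alpha> / \<nu> * (?D * \<delta>)"
      using alpha_nonneg nu_pos by (intro mult_left_mono) auto
    then have n: "norm (x' - x) \<le> \<alpha> / \<nu> * ?D * \<delta>"
      using kkt_displacement(1)[OF h(1,2)] by (simp add: mult_ac)
    have "norm (d j) \<le> ?D" using h(5) finite_K by (intro member_le_sum) auto
    then have "norm (d j) * \<alpha> \<le> ?D * \<alpha>" using alpha_nonneg by (rule mult_right_mono)
    then have "norm (d j) * \<alpha> * norm (x' - x) \<le> ?D * \<alpha> * (\<alpha> / \<nu> * ?D * \<delta>)"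
      using n by (rule mult_mono) (use D alpha_nonneg in auto)
    then show ?thesis using kkt_displacement(2)[OF h(1,2,5)] by (simp add: mult_ac)
  qed
  with L show ?thesis using that by blast
qed

end


section \<open>Inequalities and equalities in one family\<close>

definition local_constraints :: "problem \<Rightarrow> nat \<Rightarrow> nat set" where
  "local_constraints p i = {l \<in> constraints p. i \<in> affected p l}"

definition constraint_row :: "problem \<Rightarrow> nat \<Rightarrow> nat \<Rightarrow> nat fvec" where
  "constraint_row p i l = (if l \<le> n_ineq p then ineq_row p i l else eq_row p i (l - n_ineq p))"

definition constraint_off :: "problem \<Rightarrow> nat \<Rightarrow> nat \<Rightarrow> real" where
  "constraint_off p i l = (if l \<le> n_ineq p then ineq_off p i l else eq_off p i (l - n_ineq p))"

definition joint_multiplier :: "problem \<Rightarrow> nat fvec \<Rightarrow> nat fvec \<Rightarrow> nat \<Rightarrow> real" where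
  "joint_multiplier p mu lam l = (if l \<le> n_ineq p then coord mu l else coord lam (l - n_ineq p))"

text \<open>The row of agent \<open>i\<close> in \<open>I - P\<close> for the constraint \<open>l\<close>, as a vector of auxiliary variables.\<close>

definition mixing_row :: "problem \<Rightarrow> nat \<Rightarrow> nat \<Rightarrow> (nat \<times> nat) fvec" where
  "mixing_row p i l = unit_fvec (l, i) - (\<Sum>j\<in>nbrs p l i. weight p l i j *\<^sub>R unit_fvec (l, j))"

text \<open>The part of the constraint that does not depend on the local variable: the perturbation
  \<open>c\<close> of the affine program, affine in \<open>y\<close>.\<close>

definition offset :: "problem \<Rightarrow> nat \<Rightarrow> (nat \<times> nat) fvec \<Rightarrow> nat \<Rightarrow> real" where
  "offset p i y l = inner (mixing_row p i l) y + constraint_off p i l"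

lemma inner_mixing_row:
  "inner (mixing_row p i l) y = coord y (l, i) - (\<Sum>j\<in>nbrs p l i. weight p l i j * coord y (l, j))"
  by (simp add: mixing_row_def inner_diff_left inner_sum_left)

lemma finite_agents [simp]: "finite (agents p)"
  by (simp add: agents_def)

lemma affected_subset: "affected p l \<subseteq> agents p"
  by (auto simp: affected_def)

lemma finite_affected [simp]: "finite (affected p l)"
  using affected_subset finite_agents by (rule finite_subset)

lemma nbrs_subset: "nbrs p l i \<subseteq> affected p l"
  by (auto simp: nbrs_def)

lemma finite_nbrs [simp]: "finite (nbrs p l i)"
  using nbrs_subset finite_affected by (rule finite_subset)

lemma self_in_nbrs: "i \<in> affected p l \<Longrightarrow> i \<in> nbrs p l i"
  by (simp add: nbrs_def)

lemma finite_ineqs [simp]: "finite (ineqs p i)" and finite_eqs [simp]: "finite (eqs p i)"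
  by (auto simp: ineqs_def eqs_def)

lemma local_constraints_eq:
  "local_constraints p i = ineqs p i \<union> (\<lambda>q. n_ineq p + q) ` eqs p i" (is "_ = ?R")
proof (intro equalityI subsetI)
  fix l assume l: "l \<in> local_constraints p i"
  show "l \<in> ?R"
  proof (cases "l \<le> n_ineq p")
    case True
    then show ?thesis using l by (simp add: local_constraints_def constraints_def ineqs_def)
  next
    case False
    then have "l - n_ineq p \<in> eqs p i" "l = n_ineq p + (l - n_ineq p)"
      using l by (auto simp: local_constraints_def constraints_def eqs_def)
    then show ?thesis by blast
  qed
qed (auto simp: local_constraints_def constraints_def ineqs_def eqs_def)

lemma finite_local_constraints [simp]: "finite (local_constraints p i)"
  by (simp add: local_constraints_eq)

lemma ineqs_le: "m \<in> ineqs p i \<Longrightarrow> m \<le> n_ineq p" and eqs_nonzero: "q \<in> eqs p i \<Longrightarrow> q \<noteq> 0"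
  by (auto simp: ineqs_def eqs_def)

lemma ineqs_eqs_disjoint: "ineqs p i \<inter> (\<lambda>q. n_ineq p + q) ` eqs p i = {}"
  using ineqs_le eqs_nonzero by fastforce

lemma sum_local_constraints:
  "(\<Sum>l\<in>local_constraints p i. g l) = (\<Sum>m\<in>ineqs p i. g m) + (\<Sum>q\<in>eqs p i. g (n_ineq p + q))"
  unfolding local_constraints_eq
  by (subst sum.union_disjoint) (auto simp: ineqs_eqs_disjoint sum.reindex)

lemma ball_local_constraints:
  "(\<forall>l\<in>local_constraints p i. Q l) \<longleftrightarrow> (\<forall>m\<in>ineqs p i. Q m) \<and> (\<forall>q\<in>eqs p i. Q (n_ineq p + q))"
  unfolding local_constraints_eq by auto

lemma ineq_fun_eq:
  "m \<in> ineqs p i \<Longrightarrow> ineq_fun p i y m x = inner (constraint_row p i m) x + offset p i y m"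
  by (simp add: ineq_fun_def ineqs_le constraint_row_def constraint_off_def offset_def
      inner_mixing_row)

lemma eq_fun_eq:
  "q \<in> eqs p i \<Longrightarrow>
    eq_fun p i y q x = inner (constraint_row p i (n_ineq p + q)) x + offset p i y (n_ineq p + q)"
  by (simp add: eq_fun_def Let_def eqs_nonzero constraint_row_def constraint_off_def offset_def
      inner_mixing_row)

text \<open>A constraint affecting agent \<open>i\<close> reads \<open>y\<close> only at neighbors
  of \<open>i\<close>, including \<open>i\<close> itself, and these coordinates survive the
  restriction.\<close>

lemma offset_local_aux:
  assumes "l \<in> local_constraints p i"
  shows "offset p i (local_aux p i y) l = offset p i y l"
proof -
  have i: "i \<in> affected p l" using assms by (simp add: local_constraints_def)
  have idx: "(l, j) \<in> local_index p i" if "j \<in> nbrs p l i" for j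
    using assms that by (simp add: local_index_def local_constraints_eq)
  show ?thesis
    using idx self_in_nbrs[OF i] by (simp add: offset_def inner_mixing_row)
qed

lemma mixing_row_in_aux_space:
  assumes "l \<in> local_constraints p i"
  shows "mixing_row p i l \<in> aux_space p"
proof -
  have "(l, j) \<in> aux_index p" if "j \<in> affected p l" for j
    using assms that by (simp add: aux_index_def local_constraints_def)
  then show ?thesis
    using assms nbrs_subset[of p l i] unfolding mixing_row_def aux_space_def
    by (intro subspace_diff subspace_sum subspace_scale subspace_coord_space)
      (auto simp: local_constraints_def)
qed

lemma coord_mixing_row:
  "coord (mixing_row p j l') (l, i) = (if l' = l then (if j = i then 1 else 0)
     - (if i \<in> nbrs p l j then weight p l j i else 0) else 0)"
proof -
  have "(\<Sum>k\<in>nbrs p l' j. weight p l' j k * (if (l, i) = (l', k) then 1 else 0))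
      = (\<Sum>k\<in>nbrs p l' j. if k = i then (if l' = l then weight p l' j k else 0) else 0)"
    by (intro sum.cong) auto
  then show ?thesis by (auto simp: mixing_row_def)
qed

section \<open>The local problems as affine programs\<close>

text \<open>The KKT predicate does not involve the dual family or the constants, so it can be stated
  before these are obtained for the agent.\<close>

abbreviation agent_kkt ::
  "problem \<Rightarrow> nat \<Rightarrow> (nat \<Rightarrow> real) \<Rightarrow> nat fvec \<Rightarrow> (nat \<Rightarrow> real) \<Rightarrow> bool" where
  "agent_kkt p i \<equiv> affine_program.kkt (local_space p i) (gradient (local_space p i) (cost p i))
     (local_constraints p i) {..n_ineq p} (constraint_row p i)"

text \<open>Fixes the dual family and constants of one agent, so that a proof can obtain them from
  \<open>agent_program_exists\<close> and interpret the affine program locally.\<close>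

locale agent_program =
  fixes p :: problem and i :: nat and d :: "nat \<Rightarrow> nat fvec" and \<nu> \<alpha> :: real
  assumes program: "affine_program (local_space p i) (cost p i)
    (gradient (local_space p i) (cost p i)) (local_constraints p i) (constraint_row p i) d \<nu> \<alpha>"

sublocale agent_program \<subseteq> affine_program "local_space p i" "cost p i"
    "gradient (local_space p i) (cost p i)" "local_constraints p i" "{..n_ineq p}"
    "constraint_row p i" d \<nu> \<alpha>
  by (rule program)

lemma fvec_with_coords_exists:
  assumes "finite K"
  shows "\<exists>v\<in>coord_space K. \<forall>k\<in>K. coord v k = g k"
proof (intro bexI ballI)
  let ?v = "\<Sum>k\<in>K. g k *\<^sub>R unit_fvec k"
  show "?v \<in> coord_space K"
    by (intro subspace_sum subspace_scale subspace_coord_space) simp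
  fix j assume "j \<in> K"
  have "(\<Sum>k\<in>K. g k * (if j = k then 1 else 0)) = (\<Sum>k\<in>K. if k = j then g k else 0)"
    by (intro sum.cong) auto
  then show "coord ?v j = g j" using assms \<open>j \<in> K\<close> by simp
qed

locale regular_problem =
  fixes p :: problem
  assumes rows: "\<And>i m. i \<in> agents p \<Longrightarrow> m \<in> {1..n_ineq p} \<Longrightarrow> ineq_row p i m \<in> local_space p i"
      "\<And>i q. i \<in> agents p \<Longrightarrow> q \<in> {1..n_eq p} \<Longrightarrow> eq_row p i q \<in> local_space p i"
    and weights: "\<And>l. l \<in> constraints p \<Longrightarrow> mixing_weights p l"
    and cost_differentiable: "\<And>i. i \<in> agents p \<Longrightarrow> cost p i differentiable_on local_space p i"
    and cost_strongly_convex: "\<And>i. i \<in> agents p \<Longrightarrow>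
        \<exists>\<nu>>0. strongly_convex_on \<nu> (local_space p i) (cost p i)"
    and cost_lipschitz_gradient: "\<And>i. i \<in> agents p \<Longrightarrow>
        \<exists>\<alpha>>0. \<alpha>-lipschitz_on (local_space p i) (gradient (local_space p i) (cost p i))"
    and full_row_rank: "\<And>i. i \<in> agents p \<Longrightarrow>
        dim (local_rows p i) = card (ineqs p i) + card (eqs p i)"
begin

text \<open>The merged family has the same set of rows as the local matrix and an index set of the
  same total cardinality, so the rank condition yields independence and a dual family. Its members
  lie in the span of the rows, hence in the local space.\<close>

lemma agent_program_exists:
  assumes i: "i \<in> agents p"
  obtains d \<nu> \<alpha> where "agent_program p i d \<nu> \<alpha>"
proof -
  let ?U = "local_space p i" and ?K = "local_constraints p i" and ?r = "constraint_row p i"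
  obtain \<nu> where \<nu>: "\<nu> > 0" "strongly_convex_on \<nu> ?U (cost p i)"
    using cost_strongly_convex[OF i] by blast
  obtain \<alpha> where \<alpha>: "\<alpha>-lipschitz_on ?U (gradient ?U (cost p i))"
    using cost_lipschitz_gradient[OF i] by blast
  have U: "subspace ?U" by (simp add: local_space_def subspace_coord_space)
  have r: "?r k \<in> ?U" if "k \<in> ?K" for k
    using that rows(1)[OF i] rows(2)[OF i] unfolding local_constraints_eq
    by (auto simp: constraint_row_def ineqs_def eqs_def)
  have "?r ` ?K = local_rows p i"
  proof -
    have "?r ` ineqs p i = ineq_row p i ` ineqs p i"
      by (intro image_cong) (simp_all add: constraint_row_def ineqs_le)
    moreover have "(\<lambda>q. ?r (n_ineq p + q)) ` eqs p i = eq_row p i ` eqs p i"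
      by (intro image_cong) (simp_all add: constraint_row_def eqs_nonzero)
    ultimately show ?thesis
      by (simp add: local_constraints_eq local_rows_def image_Un image_image)
  qed
  moreover have "card ?K = card (ineqs p i) + card (eqs p i)"
    unfolding local_constraints_eq
    by (subst card_Un_disjoint) (auto simp: ineqs_eqs_disjoint card_image)
  ultimately have dim: "dim (?r ` ?K) = card ?K"
    using full_row_rank[OF i] by simp
  obtain d where d: "\<And>k. k \<in> ?K \<Longrightarrow> d k \<in> span (?r ` ?K)"
    "\<And>j k. j \<in> ?K \<Longrightarrow> k \<in> ?K \<Longrightarrow> inner (?r j) (d k) = (if j = k then 1 else 0)"
    using dual_family_exists[OF finite_local_constraints
        dim_eq_card_imp_independent[OF finite_local_constraints dim]] by blast
  have "span (?r ` ?K) \<subseteq> ?U" using r U by (intro span_minimal) auto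
  then have dU: "d k \<in> ?U" if "k \<in> ?K" for k using d(1)[OF that] by blast
  have "agent_program p i d \<nu> \<alpha>"
  proof (intro agent_program.intro affine_program.intro)
    show "subspace ?U" by (rule U)
    show "compact (?U \<inter> cball a \<rho>)" for a \<rho>
      by (simp add: local_space_def compact_coord_space_cball)
    show "gradient ?U (cost p i) x \<in> ?U" if "x \<in> ?U" for x
      using that cost_differentiable[OF i] unfolding local_space_def
      by (intro gradient_in_coord_space) (auto simp: differentiable_on_def)
  qed (use \<nu> \<alpha> r d(2) dU in \<open>auto simp: strongly_convex_on_def\<close>)
  then show ?thesis by (rule that)
qed

lemma feasible_eq:
  assumes "i \<in> agents p"
  shows "feasible p i y = affine_program.feas (local_space p i) (local_constraints p i)
    {..n_ineq p} (constraint_row p i) (offset p i y)"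
proof -
  obtain d \<nu> \<alpha> where "agent_program p i d \<nu> \<alpha>"
    using agent_program_exists[OF assms] .
  then interpret agent_program p i d \<nu> \<alpha> .
  show ?thesis
    by (simp add: feasible_def feas_def ball_local_constraints ineq_fun_eq eq_fun_eq ineqs_le
        eqs_nonzero)
qed

lemma agent_kkt_exists:
  assumes "i \<in> agents p"
  shows "\<exists>x w. agent_kkt p i c x w"
proof -
  obtain d \<nu> \<alpha> where "agent_program p i d \<nu> \<alpha>"
    using agent_program_exists[OF assms] .
  then interpret agent_program p i d \<nu> \<alpha> .
  show ?thesis by (rule kkt_exists)
qed

lemma local_minimizer_iff:
  assumes i: "i \<in> agents p" and kkt: "agent_kkt p i (offset p i y) x w"
  shows "local_minimizer p i y z \<longleftrightarrow> z = x"
proof -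
  obtain d \<nu> \<alpha> where "agent_program p i d \<nu> \<alpha>"
    using agent_program_exists[OF i] .
  then interpret agent_program p i d \<nu> \<alpha> .
  have "x \<in> feas (offset p i y)" using kkt by (simp add: kkt_def)
  then show ?thesis
    using kkt_minimizer[OF kkt] unfolding local_minimizer_def feasible_eq[OF i]
    by (metis order_antisym)
qed

lemma local_value_eq:
  assumes i: "i \<in> agents p" and kkt: "agent_kkt p i (offset p i y) x w"
  shows "local_value p i y = cost p i x"
proof -
  have "local_minimizer p i y x" using local_minimizer_iff[OF assms] by simp
  then show ?thesis unfolding local_value_def local_minimizer_def
    by (intro cInf_eq_minimum) auto
qed

text \<open>One side asks for a minimizer, the other only for a feasible point. They agree since a
  feasible point satisfying the KKT conditions is the minimizer.\<close>

lemma KKT_multipliers_iff: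
  assumes i: "i \<in> agents p"
  shows "KKT_multipliers p i y mu lam \<longleftrightarrow>
    mu \<in> coord_space (ineqs p i) \<and> lam \<in> coord_space (eqs p i) \<and>
    (\<exists>x. agent_kkt p i (offset p i y) x (joint_multiplier p mu lam))"
proof -
  obtain d \<nu> \<alpha> where "agent_program p i d \<nu> \<alpha>"
    using agent_program_exists[OF i] .
  then interpret agent_program p i d \<nu> \<alpha> .
  let ?w = "joint_multiplier p mu lam" and ?c = "offset p i y"
  have "(\<Sum>k\<in>local_constraints p i. ?w k *\<^sub>R constraint_row p i k)
      = (\<Sum>m\<in>ineqs p i. coord mu m *\<^sub>R ineq_row p i m)
        + (\<Sum>q\<in>eqs p i. coord lam q *\<^sub>R eq_row p i q)"
    unfolding sum_local_constraints
    by (intro arg_cong2[of _ _ _ _ "(+)"] sum.cong)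
      (auto simp: joint_multiplier_def constraint_row_def ineqs_le dest: eqs_nonzero)
  \<comment> \<open>Equality indices start at one, so their shifted copies exceed
    \<open>n_ineq p\<close>.\<close>
  moreover have "local_constraints p i \<inter> {..n_ineq p} = ineqs p i"
    using ineqs_le[of _ p i] eqs_nonzero[of _ p i] by (force simp: local_constraints_eq)
  ultimately have iff: "kkt ?c x ?w \<longleftrightarrow> x \<in> feasible p i y \<and> (\<forall>m\<in>ineqs p i. coord mu m \<ge> 0)
      \<and> gradient (local_space p i) (cost p i) x
          + (\<Sum>m\<in>ineqs p i. coord mu m *\<^sub>R ineq_row p i m)
          + (\<Sum>q\<in>eqs p i. coord lam q *\<^sub>R eq_row p i q) = 0
      \<and> (\<forall>m\<in>ineqs p i. coord mu m * ineq_fun p i y m x = 0)" for x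
    unfolding kkt_def feasible_eq[OF i]
    by (auto simp: joint_multiplier_def ineqs_le ineq_fun_eq add.assoc)
  show ?thesis
    unfolding KKT_multipliers_def iff using local_minimizer_iff[OF i, of y _ ?w] iff
    by (auto simp: local_minimizer_def)
qed

lemma unique_minimizer:
  assumes "i \<in> agents p"
  shows "\<exists>!x. local_minimizer p i y x"
  using agent_kkt_exists[OF assms] local_minimizer_iff[OF assms] by metis

text \<open>A joint multiplier is split into its two ranges of indices. On constraints affecting the
  agent its values are unique by \<open>kkt_unique\<close>; all other coordinates vanish by
  membership in the coordinate spaces.\<close>

lemma unique_multipliers:
  assumes i: "i \<in> agents p"
  shows "\<exists>!(mu, lam). KKT_multipliers p i y mu lam"
proof -
  obtain d \<nu> \<alpha> where "agent_program p i d \<nu> \<alpha>"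
    using agent_program_exists[OF i] .
  then interpret agent_program p i d \<nu> \<alpha> .
  let ?c = "offset p i y"
  obtain x w where xw: "kkt ?c x w" using kkt_exists by blast
  obtain mu where mu: "mu \<in> coord_space (ineqs p i)" "\<And>m. m \<in> ineqs p i \<Longrightarrow> coord mu m = w m"
    using fvec_with_coords_exists[OF finite_ineqs] by blast
  obtain lam where lam: "lam \<in> coord_space (eqs p i)"
    "\<And>q. q \<in> eqs p i \<Longrightarrow> coord lam q = w (n_ineq p + q)"
    using fvec_with_coords_exists[OF finite_eqs, of p i "\<lambda>q. w (n_ineq p + q)"] by blast
  have "joint_multiplier p mu lam l = w l" if "l \<in> local_constraints p i" for l
    using that mu(2) lam(2)
    by (auto simp: local_constraints_eq joint_multiplier_def ineqs_le dest: eqs_nonzero)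
  then have kkt: "kkt ?c x (joint_multiplier p mu lam)"
    using xw kkt_cong by blast
  show ?thesis
  proof (rule ex1I[of _ "(mu, lam)"])
    show "case (mu, lam) of (mu, lam) \<Rightarrow> KKT_multipliers p i y mu lam"
      using kkt mu(1) lam(1) by (auto simp: KKT_multipliers_iff[OF i])
  next
    fix z assume "case z of (mu, lam) \<Rightarrow> KKT_multipliers p i y mu lam"
    then obtain mu' lam' where z: "z = (mu', lam')" and
      ml: "mu' \<in> coord_space (ineqs p i)" "lam' \<in> coord_space (eqs p i)" and
      "\<exists>x. kkt ?c x (joint_multiplier p mu' lam')"
      by (cases z) (auto simp: KKT_multipliers_iff[OF i])
    then have *: "joint_multiplier p mu' lam' l = joint_multiplier p mu lam l"
      if "l \<in> local_constraints p i" for l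
      using kkt_unique(2)[OF kkt] that by blast
    have "coord mu' m = coord mu m" for m
    proof (cases "m \<in> ineqs p i")
      case True
      then show ?thesis
        using *[of m] by (simp add: local_constraints_eq joint_multiplier_def ineqs_le)
    qed (use ml mu(1) in \<open>simp add: coord_space_def\<close>)
    moreover have "coord lam' q = coord lam q" for q
    proof (cases "q \<in> eqs p i")
      case True
      then show ?thesis
        using *[of "n_ineq p + q"] eqs_nonzero[OF True]
        by (simp add: local_constraints_eq joint_multiplier_def)
    qed (use ml lam(1) in \<open>simp add: coord_space_def\<close>)
    ultimately show "z = (mu, lam)" using z by (auto intro: fvec_eqI)
  qed
qed

section \<open>The gradient field of the total value\<close>

text \<open>The choice is determined on the constraints affecting the agent. Offsets are taken at
  the full \<open>y\<close>, where they agree with those at the restricted vector.\<close>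

definition multiplier :: "nat \<Rightarrow> (nat \<times> nat) fvec \<Rightarrow> nat \<Rightarrow> real" where
  "multiplier i y = (SOME w. \<exists>x. agent_kkt p i (offset p i y) x w)"

text \<open>The chain rule: the multipliers are the derivatives of the local values in the offsets,
  and \<open>mixing_row\<close> is the gradient of an offset in \<open>y\<close>.\<close>

definition value_gradient :: "(nat \<times> nat) fvec \<Rightarrow> (nat \<times> nat) fvec" where
  "value_gradient y =
     (\<Sum>i\<in>agents p. \<Sum>l\<in>local_constraints p i. multiplier i y l *\<^sub>R mixing_row p i l)"

lemma multiplier_kkt:
  assumes "i \<in> agents p"
  shows "\<exists>x. agent_kkt p i (offset p i y) x (multiplier i y)"
proof -
  have "\<exists>w x. agent_kkt p i (offset p i y) x w" using agent_kkt_exists[OF assms] by blast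
  then show ?thesis unfolding multiplier_def by (rule someI_ex)
qed

lemma multiplier_unique:
  assumes i: "i \<in> agents p" and kkt: "agent_kkt p i (offset p i y) x w"
    and l: "l \<in> local_constraints p i"
  shows "multiplier i y l = w l"
proof -
  obtain d \<nu> \<alpha> where "agent_program p i d \<nu> \<alpha>"
    using agent_program_exists[OF i] .
  then interpret agent_program p i d \<nu> \<alpha> .
  show ?thesis using multiplier_kkt[OF i] kkt_unique(2)[OF kkt _ l] by blast
qed

lemma offset_diff: "offset p i y' l - offset p i y l = inner (mixing_row p i l) (y' - y)"
  by (simp add: offset_def inner_diff_right)

lemma local_value_subgradient:
  assumes i: "i \<in> agents p"
  shows "local_value p i (local_aux p i y') - local_value p i (local_aux p i y)
    \<ge> (\<Sum>l\<in>local_constraints p i. multiplier i y l * inner (mixing_row p i l) (y' - y))"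
proof -
  obtain d \<nu> \<alpha> where "agent_program p i d \<nu> \<alpha>"
    using agent_program_exists[OF i] .
  then interpret agent_program p i d \<nu> \<alpha> .
  \<comment> \<open>The local value is evaluated at the restricted vector, while
    \<open>multiplier\<close> refers to the full one.\<close>
  have cong: "kkt (offset p i (local_aux p i z)) x w \<longleftrightarrow> kkt (offset p i z) x w" for z x w
    by (intro kkt_cong) (simp_all add: offset_local_aux)
  obtain x x' where x: "kkt (offset p i y) x (multiplier i y)"
    and x': "kkt (offset p i y') x' (multiplier i y')"
    using multiplier_kkt[OF i] by blast
  have "x' \<in> feas (offset p i y')" using x' by (simp add: kkt_def)
  from kkt_lower_bound[OF x this] have "cost p i x' \<ge> cost p i x
      + (\<Sum>l\<in>local_constraints p i. multiplier i y l * inner (mixing_row p i l) (y' - y))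
      + \<nu> / 2 * (norm (x' - x))\<^sup>2"
    by (simp only: offset_diff)
  moreover have "\<nu> / 2 * (norm (x' - x))\<^sup>2 \<ge> 0" using nu_pos by simp
  moreover have "local_value p i (local_aux p i y) = cost p i x"
    by (rule local_value_eq[OF i iffD2[OF cong x]])
  moreover have "local_value p i (local_aux p i y') = cost p i x'"
    by (rule local_value_eq[OF i iffD2[OF cong x']])
  ultimately show ?thesis by linarith
qed

lemma total_value_subgradient:
  "total_value p y' - total_value p y \<ge> inner (value_gradient y) (y' - y)"
proof -
  have "inner (value_gradient y) (y' - y) = (\<Sum>i\<in>agents p. \<Sum>l\<in>local_constraints p i.
      multiplier i y l * inner (mixing_row p i l) (y' - y))"
    by (simp add: value_gradient_def inner_sum_left)
  also have "\<dots> \<le> (\<Sum>i\<in>agents p.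
      local_value p i (local_aux p i y') - local_value p i (local_aux p i y))"
    by (intro sum_mono local_value_subgradient)
  finally show ?thesis by (simp add: total_value_def sum_subtractf)
qed

lemma multiplier_lipschitz_aux:
  assumes i: "i \<in> agents p"
  shows "\<exists>L\<ge>0. \<forall>y y'. \<forall>l\<in>local_constraints p i.
    \<bar>multiplier i y' l - multiplier i y l\<bar> \<le> L * norm (y' - y)"
proof -
  obtain d \<nu> \<alpha> where "agent_program p i d \<nu> \<alpha>"
    using agent_program_exists[OF i] .
  then interpret agent_program p i d \<nu> \<alpha> .
  obtain L where L: "L \<ge> 0"
    "\<And>c x w c' x' w' \<delta> j. kkt c x w \<Longrightarrow> kkt c' x' w' \<Longrightarrow>
      (\<And>k. k \<in> local_constraints p i \<Longrightarrow> \<bar>c' k - c k\<bar> \<le> \<delta>) \<Longrightarrow> \<delta> \<ge> 0 \<Longrightarrow>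
      j \<in> local_constraints p i \<Longrightarrow> \<bar>w' j - w j\<bar> \<le> L * \<delta>"
    using multiplier_lipschitz by blast
  \<comment> \<open>\<open>B\<close> dominates the norm of every mixing row, so it bounds the change
    of all offsets at once.\<close>
  define B where "B = (\<Sum>l\<in>local_constraints p i. norm (mixing_row p i l))"
  have B: "B \<ge> 0" unfolding B_def by (intro sum_nonneg) auto
  have "\<bar>multiplier i y' l - multiplier i y l\<bar> \<le> (L * B) * norm (y' - y)"
    if l: "l \<in> local_constraints p i" for y y' l
  proof -
    obtain x x' where x: "kkt (offset p i y) x (multiplier i y)"
      "kkt (offset p i y') x' (multiplier i y')"
      using multiplier_kkt[OF i] by blast
    have "\<bar>offset p i y' k - offset p i y k\<bar> \<le> B * norm (y' - y)"
      if "k \<in> local_constraints p i" for k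
    proof -
      have "\<bar>offset p i y' k - offset p i y k\<bar> \<le> norm (mixing_row p i k) * norm (y' - y)"
        unfolding offset_diff by (rule Cauchy_Schwarz_ineq2)
      also have "\<dots> \<le> B * norm (y' - y)" unfolding B_def
        using that by (intro mult_right_mono member_le_sum) auto
      finally show ?thesis .
    qed
    from L(2)[OF x this _ l] B show ?thesis by (simp add: mult.assoc)
  qed
  then show ?thesis using L(1) B by (intro exI[of _ "L * B"]) auto
qed

lemma value_gradient_lipschitz: "\<exists>L. L-lipschitz_on S value_gradient"
proof -
  obtain L where L: "\<And>i. i \<in> agents p \<Longrightarrow> L i \<ge> 0"
    "\<And>i y y' l. i \<in> agents p \<Longrightarrow> l \<in> local_constraints p i \<Longrightarrow>
      \<bar>multiplier i y' l - multiplier i y l\<bar> \<le> L i * norm (y' - y)"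
    using multiplier_lipschitz_aux by metis
  let ?L = "\<Sum>i\<in>agents p. \<Sum>l\<in>local_constraints p i. L i * norm (mixing_row p i l)"
  have "?L-lipschitz_on S value_gradient"
  proof (rule lipschitz_onI)
    show "0 \<le> ?L" using L(1) by (intro sum_nonneg) auto
    fix y' y
    have "value_gradient y' - value_gradient y = (\<Sum>i\<in>agents p. \<Sum>l\<in>local_constraints p i.
        (multiplier i y' l - multiplier i y l) *\<^sub>R mixing_row p i l)"
      by (simp add: value_gradient_def sum_subtractf scaleR_diff_left)
    also have "norm \<dots> \<le> (\<Sum>i\<in>agents p. \<Sum>l\<in>local_constraints p i.
        L i * norm (y' - y) * norm (mixing_row p i l))"
    proof (intro sum_norm_le)
      fix i l assume "i \<in> agents p" "l \<in> local_constraints p i"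
      then show "norm ((multiplier i y' l - multiplier i y l) *\<^sub>R mixing_row p i l)
          \<le> L i * norm (y' - y) * norm (mixing_row p i l)"
        using L(2) by (simp add: mult_right_mono)
    qed
    also have "\<dots> = ?L * norm (y' - y)"
      unfolding sum_distrib_right by (intro sum.cong refl) (simp only: mult_ac)
    finally show "dist (value_gradient y') (value_gradient y) \<le> ?L * dist y' y"
      by (simp add: dist_norm)
  qed
  then show ?thesis by blast
qed

lemma value_gradient_in_aux_space: "value_gradient y \<in> aux_space p"
proof -
  have "subspace (aux_space p)" by (simp add: aux_space_def subspace_coord_space)
  then show ?thesis unfolding value_gradient_def
    by (intro subspace_sum subspace_scale mixing_row_in_aux_space)
qed

lemma total_value_has_derivative:
  assumes "y \<in> aux_space p"
  shows "(total_value p has_derivative (\<lambda>h. inner (value_gradient y) h)) (at y within aux_space p)"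
proof -
  obtain L where "L-lipschitz_on (aux_space p) value_gradient"
    using value_gradient_lipschitz by blast
  then show ?thesis
    using total_value_subgradient assms by (intro subgradient_has_derivative)
qed

lemma gradient_total_value:
  assumes "y \<in> aux_space p"
  shows "gradient (aux_space p) (total_value p) y = value_gradient y"
  using assms total_value_has_derivative[OF assms] value_gradient_in_aux_space
  by (intro gradient_eqI) (auto simp: aux_space_def subspace_coord_space)

section \<open>Coordinates of the gradient\<close>

text \<open>Agent \<open>j\<close> contributes its row of \<open>I - P\<close>, whose coordinate
  \<open>(l, i)\<close> is the entry in row \<open>j\<close> and column \<open>i\<close>; summing
  over \<open>j\<close> produces the transpose. Agents not affected by \<open>l\<close> contribute
  nothing.\<close>

lemma coord_value_gradient:
  assumes l: "l \<in> constraints p" and i: "i \<in> affected p l"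
    and v: "\<And>j. j \<in> affected p l \<Longrightarrow> v j = multiplier j y l"
  shows "coord (value_gradient y) (l, i) = I_minus_P_transpose p l v i"
proof -
  \<comment> \<open>Weights vanish off the neighborhood, so the row summed over neighbors is the
    full matrix row.\<close>
  have entry: "(if i \<in> nbrs p l j then weight p l j i else 0) = weight p l j i"
    if "j \<in> affected p l" for j
  proof -
    have "if i \<in> nbrs p l j then weight p l j i > 0 else weight p l j i = 0"
      using weights[OF l] that i unfolding mixing_weights_def by blast
    then show ?thesis by simp
  qed
  have "coord (value_gradient y) (l, i) = (\<Sum>j\<in>agents p. \<Sum>l'\<in>local_constraints p j.
      multiplier j y l' * coord (mixing_row p j l') (l, i))"
    by (simp add: value_gradient_def)
  also have "\<dots> = (\<Sum>j\<in>agents p. if j \<in> affected p l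
      then multiplier j y l * coord (mixing_row p j l) (l, i) else 0)"
  proof (rule sum.cong)
    fix j
    have "(\<Sum>l'\<in>local_constraints p j. multiplier j y l' * coord (mixing_row p j l') (l, i))
        = (\<Sum>l'\<in>local_constraints p j.
            if l' = l then multiplier j y l * coord (mixing_row p j l) (l, i) else 0)"
      by (intro sum.cong) (auto simp: coord_mixing_row)
    also have "\<dots> = (if j \<in> affected p l
        then multiplier j y l * coord (mixing_row p j l) (l, i) else 0)"
    proof -
      have "l \<in> local_constraints p j \<longleftrightarrow> j \<in> affected p l"
        using l by (simp add: local_constraints_def)
      then show ?thesis by simp
    qed
    finally show "(\<Sum>l'\<in>local_constraints p j.
        multiplier j y l' * coord (mixing_row p j l') (l, i)) = \<dots>" .
  qed simp
  also have "\<dots> = (\<Sum>j\<in>affected p l. multiplier j y l * coord (mixing_row p j l) (l, i))"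
    using affected_subset[of p l] by (simp add: sum.inter_restrict[symmetric] Int_absorb1)
  also have "\<dots> = I_minus_P_transpose p l v i"
    unfolding I_minus_P_transpose_def
  proof (rule sum.cong)
    fix j assume j: "j \<in> affected p l"
    show "multiplier j y l * coord (mixing_row p j l) (l, i)
        = ((if j = i then 1 else 0) - weight p l j i) * v j"
      using entry[OF j] v[OF j] by (simp add: coord_mixing_row mult.commute)
  qed simp
  finally show ?thesis .
qed

text \<open>Passes from the chosen multipliers to arbitrary KKT multipliers of the local problems,
  which agree with them by uniqueness.\<close>

lemma coord_gradient_total_value:
  assumes y: "y \<in> aux_space p"
    and KKT: "\<And>i. i \<in> agents p \<Longrightarrow> KKT_multipliers p i (local_aux p i y) (mu i) (lam i)"
    and l: "l \<in> constraints p" and i: "i \<in> affected p l"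
  shows "coord (gradient (aux_space p) (total_value p) y) (l, i)
    = I_minus_P_transpose p l (\<lambda>j. joint_multiplier p (mu j) (lam j) l) i"
  unfolding gradient_total_value[OF y]
proof (rule coord_value_gradient[OF l i])
  fix j assume "j \<in> affected p l"
  then have j: "j \<in> agents p" "l \<in> local_constraints p j"
    using l affected_subset[of p l] by (auto simp: local_constraints_def)
  obtain d \<nu> \<alpha> where "agent_program p j d \<nu> \<alpha>"
    using agent_program_exists[OF j(1)] .
  then interpret agent_program p j d \<nu> \<alpha> .
  obtain x where "kkt (offset p j (local_aux p j y)) x (joint_multiplier p (mu j) (lam j))"
    using KKT[OF j(1)] KKT_multipliers_iff[OF j(1)] by blast
  moreover have "kkt (offset p j (local_aux p j y)) x w \<longleftrightarrow> kkt (offset p j y) x w" for w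
    by (intro kkt_cong) (simp_all add: offset_local_aux)
  ultimately have "kkt (offset p j y) x (joint_multiplier p (mu j) (lam j))" by blast
  from multiplier_unique[OF j(1) this j(2)]
  show "joint_multiplier p (mu j) (lam j) l = multiplier j y l" by simp
qed

end

theorem lemma2:
  fixes p :: problem
  assumes rows: "\<And>i m. i \<in> agents p \<Longrightarrow> m \<in> {1..n_ineq p} \<Longrightarrow> ineq_row p i m \<in> local_space p i"
      "\<And>i q. i \<in> agents p \<Longrightarrow> q \<in> {1..n_eq p} \<Longrightarrow> eq_row p i q \<in> local_space p i"
    and graph: "pair_sym_digraph (network p)" "pverts (network p) = agents p"
    and connected: "\<And>l i j. l \<in> constraints p \<Longrightarrow> i \<in> affected p l \<Longrightarrow> j \<in> affected p l \<Longrightarrow>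
        i \<rightarrow>\<^sup>*\<^bsub>subnetwork p l\<^esub> j"
    and weights: "\<And>l. l \<in> constraints p \<Longrightarrow> mixing_weights p l"
    and cost_differentiable: "\<And>i. i \<in> agents p \<Longrightarrow> cost p i differentiable_on local_space p i"
    and cost_strongly_convex: "\<And>i. i \<in> agents p \<Longrightarrow>
        \<exists>\<nu>>0. strongly_convex_on \<nu> (local_space p i) (cost p i)"
    and cost_lipschitz_gradient: "\<And>i. i \<in> agents p \<Longrightarrow>
        \<exists>\<alpha>>0. \<alpha>-lipschitz_on (local_space p i) (gradient (local_space p i) (cost p i))"
    and full_row_rank: "\<And>i. i \<in> agents p \<Longrightarrow>
        dim (local_rows p i) = card (ineqs p i) + card (eqs p i)"
  shows
    \<comment> \<open>the optimal value and the multipliers in the claims below are well defined\<close>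
    "(\<forall>i\<in>agents p. \<forall>yi\<in>coord_space (local_index p i).
        (\<exists>!x. local_minimizer p i yi x) \<and> (\<exists>!(mu, lam). KKT_multipliers p i yi mu lam)) \<and>
     (convex_on (aux_space p) (total_value p) \<and>
      total_value p differentiable_on aux_space p) \<and>
     (\<forall>y\<in>aux_space p. \<forall>mu lam.
        (\<forall>i\<in>agents p. KKT_multipliers p i (local_aux p i y) (mu i) (lam i)) \<longrightarrow>
        (\<forall>m\<in>{1..n_ineq p}. \<forall>i\<in>affected p m.
           coord (gradient (aux_space p) (total_value p) y) (m, i)
             = I_minus_P_transpose p m (\<lambda>j. coord (mu j) m) i) \<and>
        (\<forall>q\<in>{1..n_eq p}. \<forall>i\<in>affected p (n_ineq p + q).
           coord (gradient (aux_space p) (total_value p) y) (n_ineq p + q, i)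
             = I_minus_P_transpose p (n_ineq p + q) (\<lambda>j. coord (lam j) q) i)) \<and>
     (\<exists>\<alpha>. \<alpha>-lipschitz_on (aux_space p) (gradient (aux_space p) (total_value p)))"
proof -
  interpret regular_problem p
    using rows weights cost_differentiable cost_strongly_convex cost_lipschitz_gradient
      full_row_rank by unfold_locales
  show ?thesis
  proof (intro conjI ballI allI impI)
    show "\<exists>!x. local_minimizer p i yi x" if "i \<in> agents p" for i yi
      using that by (rule unique_minimizer)
    show "\<exists>!(mu, lam). KKT_multipliers p i yi mu lam" if "i \<in> agents p" for i yi
      using that by (rule unique_multipliers)
    show "convex_on (aux_space p) (total_value p)"
      using total_value_subgradient
      by (intro subgradient_convex_on subspace_imp_convex)
        (auto simp: aux_space_def subspace_coord_space)
    show "total_value p differentiable_on aux_space p"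
      using total_value_has_derivative by (auto simp: differentiable_on_def differentiable_def)
    obtain L where "L-lipschitz_on (aux_space p) value_gradient"
      using value_gradient_lipschitz by blast
    \<comment> \<open>The gradient is identified with \<open>value_gradient\<close> on
      \<open>aux_space p\<close>, which is all that a Lipschitz bound on this set involves.\<close>
    then have "L-lipschitz_on (aux_space p) (gradient (aux_space p) (total_value p))"
      by (rule lipschitz_on_transform) (simp add: gradient_total_value)
    then show "\<exists>\<alpha>. \<alpha>-lipschitz_on (aux_space p) (gradient (aux_space p) (total_value p))"
      by blast
  next
    fix y mu lam m i
    assume "y \<in> aux_space p"
      "\<forall>i\<in>agents p. KKT_multipliers p i (local_aux p i y) (mu i) (lam i)"
      "m \<in> {1..n_ineq p}" "i \<in> affected p m"
    then show "coord (gradient (aux_space p) (total_value p) y) (m, i)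
        = I_minus_P_transpose p m (\<lambda>j. coord (mu j) m) i"
      using coord_gradient_total_value[of y mu lam m i]
      by (simp add: constraints_def joint_multiplier_def)
  next
    fix y mu lam q i
    assume "y \<in> aux_space p"
      "\<forall>i\<in>agents p. KKT_multipliers p i (local_aux p i y) (mu i) (lam i)"
      "q \<in> {1..n_eq p}" "i \<in> affected p (n_ineq p + q)"
    \<comment> \<open>As \<open>q\<close> is at least one, the index lies past
      \<open>n_ineq p\<close> and the joint multiplier reads coordinate \<open>q\<close> of
      \<open>lam\<close>.\<close>
    then show "coord (gradient (aux_space p) (total_value p) y) (n_ineq p + q, i)
        = I_minus_P_transpose p (n_ineq p + q) (\<lambda>j. coord (lam j) q) i"
      using coord_gradient_total_value[of y mu lam "n_ineq p + q" i]
      by (simp add: constraints_def joint_multiplier_def)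
  qed
qed

end
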